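(* There is an algorithm that, given an integer $n\ge 2$, an integer $k\in\{1,\dots,n\}$ and real numbers $0\le a_1\le\cdots\le a_n\le 1$, computes in polynomial time (a number of arithmetic operations and comparisons bounded by a polynomial in $n$) the sharp lower and upper bounds $L$ and $U$ on the probability that at least $k$ of $n$ $(n-1)$-wise independent events with marginal probabilities $a_1,\dots,a_n$ occur, where $$L=P_0(n,k,\mathbf{a})-\binom{n-1}{k-1}\alpha,\qquad U=P_0(n,k,\mathbf{a})+\binom{n-1}{k-1}\beta\qquad\text{if } k \text{ is odd},$$ $$L=P_0(n,k,\mathbf{a})-\binom{n-1}{k-1}\beta,\qquad U=P_0(n,k,\mathbf{a})+\binom{n-1}{k-1}\alpha\qquad\text{if } k \text{ is even},$$ with $$\alpha=\prod_{i=1}^{2p+1}a_i\prod_{i=2p+2}^{n}(1-a_i),\qquad \beta=\prod_{i=1}^{2m}a_i\prod_{i=2m+1}^{n}(1-a_i).$$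
   Context: $P_0(n,k,\mathbf{a}):=\sum_{J\subseteq[n],\,|J|\ge k}\ \prod_{j\in J}a_j\prod_{j\in[n]\setminus J}(1-a_j)$, where $[n]=\{1,\dots,n\}$, is the probability that at least $k$ of $n$ mutually independent events with marginal probabilities $a_1,\dots,a_n$ occur. The integer $p$ is the largest integer in $\{0,1,\dots,\lfloor (n-1)/2\rfloor\}$ such that $a_{2i}+a_{2i+1}\le 1$ for all $1\le i\le p$, and $m$ is the largest integer in $\{0,1,\dots,\lfloor n/2\rfloor\}$ such that $a_{2i-1}+a_{2i}\le 1$ for all $1\le i\le m$. Events $A_1,\dots,A_n$ are $(n-1)$-wise independent if any $n-1$ of them are mutually independent. Here $L$ and $U$ are the minimum and maximum, over all probability measures under which $n$ events with marginal probabilities $a_1,\dots,a_n$ are $(n-1)$-wise independent, of the probability that at least $k$ of the events occur. Time is measured by the number of elementary arithmetic operations and comparisons of numbers. Empty products equal $1$. *)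

theory Defs
  imports "HOL-Probability.Probability" "HOL-Computational_Algebra.Polynomial"
begin

section \<open>Events that are independent up to one\<close>

definition indep_prob_at_least :: "nat \<Rightarrow> nat \<Rightarrow> (nat \<Rightarrow> real) \<Rightarrow> real" where
  "indep_prob_at_least n k a =
     (\<Sum>J | J \<subseteq> {1..n} \<and> k \<le> card J. (\<Prod>j\<in>J. a j) * (\<Prod>j\<in>{1..n} - J. 1 - a j))"

definition n_minus_1_wise_indep :: "'w measure \<Rightarrow> nat \<Rightarrow> (nat \<Rightarrow> 'w set) \<Rightarrow> bool" where
  "n_minus_1_wise_indep M n A \<longleftrightarrow>
     (\<forall>J. J \<subseteq> {1..n} \<and> card J = n - 1 \<longrightarrow> prob_space.indep_events M A J)"

text \<open>
  All values that the probability of ``at least \<open>k\<close> of the \<open>n\<close> events occur'' can take.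
  A set cannot range over measures on all types at once, so the type of the sample points
  is a parameter. The type \<open>nat set\<close> is large enough for any joint behaviour of \<open>n\<close> events:
  record each sample point as the set of indices of the events that contain it.
\<close>

definition attainable_probs ::
    "'w itself \<Rightarrow> nat \<Rightarrow> nat \<Rightarrow> (nat \<Rightarrow> real) \<Rightarrow> real set" where
  "attainable_probs _ n k a =
     {measure M {\<omega> \<in> space M. k \<le> card {i \<in> {1..n}. \<omega> \<in> A i}} | (M :: 'w measure) A.
        prob_space M \<and>
        (\<forall>i\<in>{1..n}. A i \<in> sets M \<and> measure M (A i) = a i) \<and>
        n_minus_1_wise_indep M n A}"

definition p_index :: "nat \<Rightarrow> (nat \<Rightarrow> real) \<Rightarrow> nat" where
  "p_index n a = Max {p \<in> {0..(n - 1) div 2}. \<forall>i\<in>{1..p}. a (2 * i) + a (2 * i + 1) \<le> 1}"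

definition m_index :: "nat \<Rightarrow> (nat \<Rightarrow> real) \<Rightarrow> nat" where
  "m_index n a = Max {m \<in> {0..n div 2}. \<forall>i\<in>{1..m}. a (2 * i - 1) + a (2 * i) \<le> 1}"

definition alpha :: "nat \<Rightarrow> (nat \<Rightarrow> real) \<Rightarrow> real" where
  "alpha n a =
     (\<Prod>i\<in>{1..2 * p_index n a + 1}. a i) * (\<Prod>i\<in>{2 * p_index n a + 2..n}. 1 - a i)"

definition beta :: "nat \<Rightarrow> (nat \<Rightarrow> real) \<Rightarrow> real" where
  "beta n a =
     (\<Prod>i\<in>{1..2 * m_index n a}. a i) * (\<Prod>i\<in>{2 * m_index n a + 1..n}. 1 - a i)"

section \<open>Algorithms on real numbers\<close>

text \<open>
  Algorithms are while-programs over a real random-access machine with two sorts of data: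
  natural-number variables for counting and indexing, and arrays of exact real numbers.
  A real can be used only through the four arithmetic operations and the comparison \<open>\<le>\<close>;
  there is no rounding, and program constants are integers.
\<close>

type_synonym name = string
type_synonym state = "(name \<Rightarrow> nat) \<times> (name \<Rightarrow> nat \<Rightarrow> real)"

datatype iexp = IConst nat | IVar name | IAdd iexp iexp | ISub iexp iexp

datatype rexp =
    RConst int | RCell name iexp
  | RAdd rexp rexp | RSub rexp rexp | RMul rexp rexp | RDiv rexp rexp

datatype bexp = ILe iexp iexp | RLe rexp rexp | BNot bexp | BAnd bexp bexp

datatype com =
    Skip | IAssign name iexp | RAssign name iexp rexp
  | Seq com com | Cond bexp com com | While bexp com

text \<open>
  \<open>ISub\<close> is truncated at \<open>0\<close>, and \<open>RDiv\<close> by zero yields \<open>0\<close>.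
\<close>

fun ival :: "iexp \<Rightarrow> state \<Rightarrow> nat" where
  "ival (IConst c) s = c"
| "ival (IVar x) s = fst s x"
| "ival (IAdd e f) s = ival e s + ival f s"
| "ival (ISub e f) s = ival e s - ival f s"

fun rval :: "rexp \<Rightarrow> state \<Rightarrow> real" where
  "rval (RConst c) s = of_int c"
| "rval (RCell x e) s = snd s x (ival e s)"
| "rval (RAdd e f) s = rval e s + rval f s"
| "rval (RSub e f) s = rval e s - rval f s"
| "rval (RMul e f) s = rval e s * rval f s"
| "rval (RDiv e f) s = rval e s / rval f s"

fun bval :: "bexp \<Rightarrow> state \<Rightarrow> bool" where
  "bval (ILe e f) s \<longleftrightarrow> ival e s \<le> ival f s"
| "bval (RLe e f) s \<longleftrightarrow> rval e s \<le> rval f s"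
| "bval (BNot b) s \<longleftrightarrow> \<not> bval b s"
| "bval (BAnd b c) s \<longleftrightarrow> bval b s \<and> bval c s"

text \<open>
  Every constant, memory access, arithmetic operation, comparison, Boolean connective,
  assignment and branch is charged one unit, whether it concerns reals or indices. Hence the
  total charge bounds the number of arithmetic operations and comparisons from above.
\<close>

fun icost :: "iexp \<Rightarrow> nat" where
  "icost (IConst c) = 1"
| "icost (IVar x) = 1"
| "icost (IAdd e f) = icost e + icost f + 1"
| "icost (ISub e f) = icost e + icost f + 1"

fun rcost :: "rexp \<Rightarrow> nat" where
  "rcost (RConst c) = 1"
| "rcost (RCell x e) = icost e + 1"
| "rcost (RAdd e f) = rcost e + rcost f + 1"
| "rcost (RSub e f) = rcost e + rcost f + 1"
| "rcost (RMul e f) = rcost e + rcost f + 1"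
| "rcost (RDiv e f) = rcost e + rcost f + 1"

fun bcost :: "bexp \<Rightarrow> nat" where
  "bcost (ILe e f) = icost e + icost f + 1"
| "bcost (RLe e f) = rcost e + rcost f + 1"
| "bcost (BNot b) = bcost b + 1"
| "bcost (BAnd b c) = bcost b + bcost c + 1"

text \<open>
  \<open>runs c s t s'\<close>: started in \<open>s\<close>, the program \<open>c\<close> terminates in \<open>s'\<close> at total cost \<open>t\<close>.
\<close>

inductive runs :: "com \<Rightarrow> state \<Rightarrow> nat \<Rightarrow> state \<Rightarrow> bool" where
  Skip: "runs Skip s 1 s"
| IAssign: "runs (IAssign x e) (u, v) (icost e + 1) (u(x := ival e (u, v)), v)"
| RAssign: "runs (RAssign x e f) (u, v) (icost e + rcost f + 1)
     (u, v(x := (v x)(ival e (u, v) := rval f (u, v))))"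
| Seq: "runs c s t s' \<Longrightarrow> runs d s' t' s'' \<Longrightarrow> runs (Seq c d) s (t + t') s''"
| CondTrue: "bval b s \<Longrightarrow> runs c s t s' \<Longrightarrow> runs (Cond b c d) s (bcost b + 1 + t) s'"
| CondFalse: "\<not> bval b s \<Longrightarrow> runs d s t s' \<Longrightarrow> runs (Cond b c d) s (bcost b + 1 + t) s'"
| WhileFalse: "\<not> bval b s \<Longrightarrow> runs (While b c) s (bcost b + 1) s"
| WhileTrue: "bval b s \<Longrightarrow> runs c s t s' \<Longrightarrow> runs (While b c) s' t' s'' \<Longrightarrow>
     runs (While b c) s (bcost b + 1 + t + t') s''"

inductive_cases SkipE: "runs Skip s t s'"
inductive_cases IAssignE: "runs (IAssign x e) s t s'"
inductive_cases RAssignE: "runs (RAssign x e f) s t s'"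
inductive_cases SeqE: "runs (Seq c d) s t s'"
inductive_cases CondE: "runs (Cond b c d) s t s'"
inductive_cases WhileE: "runs (While b c) s t s'"

lemma runs_deterministic:
  "runs c s t s' \<Longrightarrow> runs c s t2 s2 \<Longrightarrow> t2 = t \<and> s2 = s'"
proof (induction arbitrary: t2 s2 rule: runs.induct)
  case (Skip s)
  then show ?case by (elim SkipE) simp
next
  case (IAssign x e u v)
  then show ?case by (elim IAssignE) simp
next
  case (RAssign x e f u v)
  then show ?case by (elim RAssignE) simp
next
  case (Seq c s t s' d t' s'')
  from Seq.prems show ?case by (elim SeqE) (simp, metis Seq.IH)
next
  case (CondTrue b s c t s' d)
  from CondTrue.prems show ?case by (elim CondE) (use CondTrue.hyps(1) in \<open>auto dest: CondTrue.IH\<close>)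
next
  case (CondFalse b s d t s' c)
  from CondFalse.prems show ?case by (elim CondE) (use CondFalse.hyps(1) in \<open>auto dest: CondFalse.IH\<close>)
next
  case (WhileFalse b s c)
  from WhileFalse.prems WhileFalse.hyps show ?case by (auto elim: runs.cases)
next
  case (WhileTrue b s c t s' t' s'')
  from WhileTrue.prems WhileTrue.hyps(1) obtain t1 s1 t1'
    where "runs c s t1 s1" "runs (While b c) s1 t1' s2" "t2 = bcost b + 1 + t1 + t1'"
    by - (erule WhileE, auto)
  then show ?case by (metis WhileTrue.IH)
qed

text \<open>
  Only \<open>a\<^sub>1, \<dots>, a\<^sub>n\<close> are visible to the program; all remaining memory is \<open>0\<close>.
\<close>

definition input_state :: "nat \<Rightarrow> nat \<Rightarrow> (nat \<Rightarrow> real) \<Rightarrow> state" where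
  "input_state n k a =
     ((\<lambda>_. 0)(''n'' := n, ''k'' := k),
      (\<lambda>_ _. 0)(''a'' := (\<lambda>i. if i \<in> {1..n} then a i else 0)))"

end

theory Submission
  imports Defs
begin

text \<open>
  Write \<open>q\<^sub>S\<close> for the probability that exactly the events with index in \<open>S\<close> occur and \<open>p\<^sub>S\<close> for its
  value under independence. \<open>(n - 1)\<close>-wise independence fixes the sum of \<open>q\<^sub>S\<close> and
  \<open>q\<^bsub>S \<union> {x}\<^esub>\<close> for \<open>x \<notin> S\<close>, so it holds iff
  \<open>q\<^sub>S = p\<^sub>S + (-1)\<^bsup>|S|\<^esup> d\<close> for one real \<open>d\<close>, and nonnegativity confines \<open>d\<close> to the interval from minus
  the least even \<open>p\<^sub>S\<close> to the least odd \<open>p\<^sub>S\<close>. The probability that at least \<open>k\<close> events occur is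
  \<open>P\<^sub>0 + (-1)\<^sup>k (n - 1 choose k - 1) d\<close>, affine in \<open>d\<close>. For sorted marginals, an exchange argument
  shows that among sets of a given size the initial segment has the least \<open>p\<^sub>S\<close>, and lengthening a
  segment by two pays off as long as the two new marginals sum to at most 1; this
  gives \<open>\<alpha>\<close> and \<open>\<beta>\<close>. The program does not search for the segment: the least even and odd \<open>p\<^sub>S\<close> satisfy a
  recurrence in the number of events, as do the tail probabilities.
\<close>

section \<open>Atoms of independent events\<close>

text \<open>The index set \<open>N\<close> stays arbitrary because inductions insert one index at a
  time, and the deviation argument passes to \<open>{1..n}\<close> without one index.\<close>

definition atom_prob :: "(nat \<Rightarrow> real) \<Rightarrow> nat set \<Rightarrow> nat set \<Rightarrow> real" where
  "atom_prob a N S = (\<Prod>j\<in>S. a j) * (\<Prod>j\<in>N - S. 1 - a j)"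

lemma atom_prob_nonneg:
  assumes "\<And>j. j \<in> N \<Longrightarrow> 0 \<le> a j \<and> a j \<le> 1" and "S \<subseteq> N"
  shows "0 \<le> atom_prob a N S"
  unfolding atom_prob_def using assms by (intro mult_nonneg_nonneg prod_nonneg) auto

lemma atom_prob_insert:
  assumes "finite N" and "x \<notin> N" and "S \<subseteq> N"
  shows "atom_prob a (insert x N) S = atom_prob a N S * (1 - a x)"
    and "atom_prob a (insert x N) (insert x S) = atom_prob a N S * a x"
proof -
  have "insert x N - S = insert x (N - S)" "insert x N - insert x S = N - S" "x \<notin> S" "finite S"
    using assms finite_subset by auto
  then show "atom_prob a (insert x N) S = atom_prob a N S * (1 - a x)"
    "atom_prob a (insert x N) (insert x S) = atom_prob a N S * a x"
    using assms by (simp_all add: atom_prob_def)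
qed

lemma sum_Pow_insert:
  assumes "finite N" and "x \<notin> N"
  shows "(\<Sum>J\<in>Pow (insert x N). f J) = (\<Sum>J\<in>Pow N. f J) + (\<Sum>J\<in>Pow N. f (insert x J))"
proof -
  have "inj_on (insert x) (Pow N)"
    using assms(2) by (auto simp: inj_on_def)
  moreover have "Pow N \<inter> insert x ` Pow N = {}"
    using assms(2) by auto
  ultimately show ?thesis
    using assms(1) by (simp add: Pow_insert sum.union_disjoint sum.reindex)
qed

lemma sum_card_ge:
  assumes "finite N"
  shows "(\<Sum>J | J \<subseteq> N \<and> k \<le> card J. f J) = (\<Sum>J\<in>Pow N. if k \<le> card J then f J else 0)"
  using sum.inter_filter[of "Pow N" f "\<lambda>J. k \<le> card J"] assms by (simp add: Pow_def)

lemma indep_prob_at_least_eq: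
  "indep_prob_at_least n k a = (\<Sum>J\<in>Pow {1..n}. if k \<le> card J then atom_prob a {1..n} J else 0)"
  unfolding indep_prob_at_least_def atom_prob_def by (rule sum_card_ge) simp

text \<open>Split the index sets \<open>J\<close> by whether they contain \<open>Suc n\<close>, that
  is, condition on the last event. This is the recurrence that the program runs in the array
  \<open>T\<close>.\<close>

lemma indep_prob_at_least_Suc:
  "indep_prob_at_least (Suc n) (Suc k) a =
     a (Suc n) * indep_prob_at_least n k a + (1 - a (Suc n)) * indep_prob_at_least n (Suc k) a"
proof -
  let ?N = "{1..n}"
  have N: "{1..Suc n} = insert (Suc n) ?N" and notin: "Suc n \<notin> ?N"
    by auto
  have card: "card (insert (Suc n) J) = Suc (card J)" if "J \<in> Pow ?N" for J
    using that finite_subset[of J ?N] by (subst card_insert_disjoint) auto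
  have "(\<Sum>J\<in>Pow ?N. if Suc k \<le> card J then atom_prob a (insert (Suc n) ?N) J else 0) =
      (1 - a (Suc n)) * indep_prob_at_least n (Suc k) a"
    unfolding indep_prob_at_least_eq sum_distrib_left
    by (intro sum.cong refl)
       (simp only: atom_prob_insert notin finite_atLeastAtMost Pow_iff not_False_eq_True
         mult.commute mult_zero_right split: if_split, simp)
  moreover have "(\<Sum>J\<in>Pow ?N. if Suc k \<le> card (insert (Suc n) J)
        then atom_prob a (insert (Suc n) ?N) (insert (Suc n) J) else 0) =
      a (Suc n) * indep_prob_at_least n k a"
    unfolding indep_prob_at_least_eq sum_distrib_left
    by (intro sum.cong refl)
       (simp only: card Suc_le_mono atom_prob_insert notin finite_atLeastAtMost Pow_iff not_False_eq_True
         mult.commute mult_zero_right split: if_split, simp)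
  ultimately show ?thesis
    unfolding indep_prob_at_least_eq[of "Suc n"] N sum_Pow_insert[OF finite_atLeastAtMost notin] by simp
qed

text \<open>With \<open>S = K \<union> X\<close> and \<open>X \<subseteq> N - K\<close>, the sum
  over \<open>X\<close> is the expansion of a product of binomials \<open>f i + g i\<close>.\<close>

lemma sum_supersets_prod:
  fixes f g :: "'a \<Rightarrow> 'b::comm_ring_1"
  assumes "finite N" and "K \<subseteq> N"
  shows "(\<Sum>S | K \<subseteq> S \<and> S \<subseteq> N. prod f S * prod g (N - S)) = prod f K * (\<Prod>i\<in>N - K. f i + g i)"
proof -
  have fin: "finite (N - K)" "finite K"
    using assms finite_subset by auto
  have bij: "bij_betw (\<lambda>X. K \<union> X) (Pow (N - K)) {S. K \<subseteq> S \<and> S \<subseteq> N}"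
    by (rule bij_betw_byWitness[where f' = "\<lambda>S. S - K"]) (use assms in auto)
  have "(\<Sum>S | K \<subseteq> S \<and> S \<subseteq> N. prod f S * prod g (N - S)) =
      (\<Sum>X\<in>Pow (N - K). prod f (K \<union> X) * prod g (N - (K \<union> X)))"
    using sum.reindex_bij_betw[OF bij, of "\<lambda>S. prod f S * prod g (N - S)"] by simp
  also have "\<dots> = (\<Sum>X\<in>Pow (N - K). prod f K * (prod f X * prod g (N - K - X)))"
  proof (rule sum.cong[OF refl])
    fix X assume "X \<in> Pow (N - K)"
    then have "X \<inter> K = {}" "finite X"
      using fin finite_subset by auto
    then show "prod f (K \<union> X) * prod g (N - (K \<union> X)) = prod f K * (prod f X * prod g (N - K - X))"
      using fin by (subst prod.union_disjoint) (auto simp: Diff_Un Int_commute mult.assoc set_diff_eq conj_assoc)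
  qed
  finally show ?thesis
    using fin by (simp add: sum_distrib_left prod_add)
qed

lemma sum_supersets_atom_prob:
  assumes "finite N" and "K \<subseteq> N"
  shows "(\<Sum>S | K \<subseteq> S \<and> S \<subseteq> N. atom_prob a N S) = prod a K"
  using sum_supersets_prod[OF assms, of a "\<lambda>j. 1 - a j"] by (simp add: atom_prob_def)

text \<open>Take \<open>f = -1\<close> and \<open>g = 1\<close> in the product expansion:
  \<open>N - K\<close> is nonempty and each of its factors is 0. Hence an alternating perturbation
  of the atoms leaves the intersection probability of every proper subfamily unchanged.\<close>

lemma sum_supersets_sign:
  assumes "finite N" and "K \<subset> N"
  shows "(\<Sum>S | K \<subseteq> S \<and> S \<subseteq> N. (-1) ^ card S) = (0::real)"
  using sum_supersets_prod[of N K "\<lambda>_. -1" "\<lambda>_. 1::real"] assms by (auto simp: power_0_left card_gt_0_iff)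

text \<open>Pair \<open>J\<close> with \<open>insert x J\<close> for a fixed \<open>x\<close>. The
  two signs cancel unless only the larger set reaches size \<open>k\<close>, which happens exactly
  for \<open>card J = k - 1\<close>.\<close>

lemma sum_sign_card_ge:
  assumes "finite N" and "N \<noteq> {}" and "1 \<le> k"
  shows "(\<Sum>J\<in>Pow N. if k \<le> card J then (-1) ^ card J else 0) =
    ((-1) ^ k * real ((card N - 1) choose (k - 1)))"
proof -
  from \<open>N \<noteq> {}\<close> obtain x N' where N: "N = insert x N'" "x \<notin> N'"
    by (metis Set.set_insert all_not_in_conv)
  have fin: "finite N'"
    using assms N by simp
  have card: "card (insert x J) = Suc (card J)" if "J \<in> Pow N'" for J
    using that N fin finite_subset[of J N'] by (subst card_insert_disjoint) auto
  have "(\<Sum>J\<in>Pow N. if k \<le> card J then (-1) ^ card J else (0::real)) =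
      (\<Sum>J\<in>Pow N'. if card J = k - 1 then (-1) ^ k else 0)"
    unfolding N(1) sum_Pow_insert[OF fin N(2)] sum.distrib[symmetric]
    using \<open>1 \<le> k\<close> by (intro sum.cong) (auto simp: card)
  also have "\<dots> = (\<Sum>J\<in>{J \<in> Pow N'. card J = k - 1}. (-1) ^ k)"
    using fin by (subst sum.inter_filter) auto
  also have "\<dots> = (-1) ^ k * real (card N' choose (k - 1))"
    using n_subsets[OF fin, of "k - 1"] by (simp add: Pow_def)
  finally show ?thesis
    using N fin by simp
qed

section \<open>Least atoms of a given parity\<close>

definition least_atom :: "(nat \<Rightarrow> real) \<Rightarrow> nat set \<Rightarrow> bool \<Rightarrow> real \<Rightarrow> bool" where
  "least_atom a N b v \<longleftrightarrow>
     (\<exists>S\<subseteq>N. odd (card S) = b \<and> v = atom_prob a N S) \<and>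
     (\<forall>S\<subseteq>N. odd (card S) = b \<longrightarrow> v \<le> atom_prob a N S)"

text \<open>Lets the value found by the recurrence and the closed form be characterized separately
  and then identified.\<close>

lemma least_atom_unique: "least_atom a N b v \<Longrightarrow> least_atom a N b w \<Longrightarrow> v = w"
  unfolding least_atom_def by (metis order_antisym)

text \<open>An atom of \<open>insert x N\<close> is an atom of \<open>N\<close> times
  \<open>1 - a x\<close> with the same parity, or times \<open>a x\<close> with the opposite parity.
  Both factors are nonnegative, so minima pass through them. The program updates \<open>E\<close>
  and \<open>O\<close> by this rule.\<close>

lemma least_atom_insert:
  assumes fin: "finite N" and x: "x \<notin> N" and a: "0 \<le> a x" "a x \<le> 1"
    and v: "least_atom a N b v" and w: "least_atom a N (\<not> b) w"
  shows "least_atom a (insert x N) b (min (v * (1 - a x)) (w * a x))"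
proof -
  have card: "card (insert x S) = Suc (card S)" if "S \<subseteq> N" for S
    using that x fin finite_subset[of S N] by (subst card_insert_disjoint) auto
  from v obtain S where S: "S \<subseteq> N" "odd (card S) = b" "v = atom_prob a N S"
    unfolding least_atom_def by blast
  from w obtain T where T: "T \<subseteq> N" "odd (card T) = (\<not> b)" "w = atom_prob a N T"
    unfolding least_atom_def by blast
  have attained: "\<exists>R\<subseteq>insert x N. odd (card R) = b \<and> min (v * (1 - a x)) (w * a x) = atom_prob a (insert x N) R"
  proof (cases "v * (1 - a x) \<le> w * a x")
    case True
    then show ?thesis
      using S fin x by (intro exI[of _ S]) (auto simp: atom_prob_insert)
  next
    case False
    then show ?thesis
      using T fin x by (intro exI[of _ "insert x T"]) (auto simp: atom_prob_insert card)
  qed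
  have lower: "min (v * (1 - a x)) (w * a x) \<le> atom_prob a (insert x N) R"
    if R: "R \<subseteq> insert x N" "odd (card R) = b" for R
  proof (cases "x \<in> R")
    case True
    then obtain R' where R': "R = insert x R'" "x \<notin> R'"
      by (metis Set.set_insert)
    with R x have sub: "R' \<subseteq> N" by auto
    with R R' card have "odd (card R') = (\<not> b)" by auto
    with w sub have "w \<le> atom_prob a N R'"
      unfolding least_atom_def by blast
    then have "w * a x \<le> atom_prob a N R' * a x"
      using a by (intro mult_right_mono) auto
    then show ?thesis
      using R' sub fin x by (simp add: atom_prob_insert min_le_iff_disj)
  next
    case False
    with R have sub: "R \<subseteq> N" by auto
    with v R have "v \<le> atom_prob a N R"
      unfolding least_atom_def by blast
    then have "v * (1 - a x) \<le> atom_prob a N R * (1 - a x)"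
      using a by (intro mult_right_mono) auto
    then show ?thesis
      using sub fin x by (simp add: atom_prob_insert min_le_iff_disj)
  qed
  from attained lower show ?thesis
    unfolding least_atom_def by blast
qed

text \<open>\<open>S\<close> and the segment differ in equally many indices, and their marginals are separated by the
  marginal \<open>c\<close> of index \<open>card S\<close>; replacing all of these marginals by \<open>c\<close> makes both atoms equal.\<close>

lemma atom_prob_initial_segment_le:
  assumes mono: "mono_on {1..n} a" and a: "\<And>j. j \<in> {1..n} \<Longrightarrow> 0 \<le> a j \<and> a j \<le> 1"
    and S: "S \<subseteq> {1..n}"
  shows "atom_prob a {1..n} {1..card S} \<le> atom_prob a {1..n} S"
proof (cases "card S = 0")
  case True
  then show ?thesis
    using S finite_subset[of S "{1..n}"] by simp
next
  case False
  define P where "P = {1..card S}"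
  define c where "c = a (card S)"
  have fin: "finite S" "finite P"
    using S finite_subset unfolding P_def by auto
  have le: "card S \<le> n"
    using card_mono[OF _ S] by simp
  have c: "0 \<le> c" "c \<le> 1"
    using a[of "card S"] False le unfolding c_def by auto
  have low: "0 \<le> a j \<and> a j \<le> c \<and> a j \<le> 1" if "j \<in> P - S" for j
    using that mono_onD[OF mono, of j "card S"] a[of j] le unfolding P_def c_def by auto
  have high: "0 \<le> a j \<and> c \<le> a j \<and> a j \<le> 1" if "j \<in> S - P" for j
    using that mono_onD[OF mono, of "card S" j] a[of j] le False S unfolding P_def c_def
    by (auto simp: not_le)
  have "card P = card S"
    by (simp add: P_def)
  then have card: "card (P - S) = card (S - P)"
    using fin by (metis card_Diff_subset_Int finite_Int Int_commute)
  \<comment> \<open>\<open>R\<close> collects the factors common to both atoms: indices in both sets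
    and indices in neither.\<close>
  define R where "R = prod a (P \<inter> S) * (\<Prod>j\<in>{1..n} - (P \<union> S). 1 - a j)"
  have pP: "prod a P = prod a (P \<inter> S) * prod a (P - S)"
    by (rule prod.Int_Diff[OF fin(2)])
  have pS: "prod a S = prod a (P \<inter> S) * prod a (S - P)"
    using prod.Int_Diff[OF fin(1), of a P] by (simp add: Int_commute)
  have "P \<subseteq> {1..n}"
    using le unfolding P_def by auto
  then have sets: "({1..n} - P) \<inter> S = S - P" "({1..n} - P) - S = {1..n} - (P \<union> S)"
    "({1..n} - S) \<inter> P = P - S" "({1..n} - S) - P = {1..n} - (P \<union> S)"
    using S by blast+
  have qP: "(\<Prod>j\<in>{1..n} - P. 1 - a j) = (\<Prod>j\<in>S - P. 1 - a j) * (\<Prod>j\<in>{1..n} - (P \<union> S). 1 - a j)"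
    using prod.Int_Diff[of "{1..n} - P" "\<lambda>j. 1 - a j" S] by (simp only: sets finite_Diff finite_atLeastAtMost)
  have qS: "(\<Prod>j\<in>{1..n} - S. 1 - a j) = (\<Prod>j\<in>P - S. 1 - a j) * (\<Prod>j\<in>{1..n} - (P \<union> S). 1 - a j)"
    using prod.Int_Diff[of "{1..n} - S" "\<lambda>j. 1 - a j" P] by (simp only: sets finite_Diff finite_atLeastAtMost)
  have "prod a (P - S) * (\<Prod>j\<in>S - P. 1 - a j) \<le> (\<Prod>j\<in>P - S. c) * (\<Prod>j\<in>S - P. 1 - c)"
    using low high c by (intro mult_mono prod_mono prod_nonneg) auto
  also have "\<dots> = (\<Prod>j\<in>S - P. c) * (\<Prod>j\<in>P - S. 1 - c)"
    by (simp add: card)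
  also have "\<dots> \<le> prod a (S - P) * (\<Prod>j\<in>P - S. 1 - a j)"
    using low high c by (intro mult_mono prod_mono prod_nonneg) auto
  finally have le: "prod a (P - S) * (\<Prod>j\<in>S - P. 1 - a j) \<le> prod a (S - P) * (\<Prod>j\<in>P - S. 1 - a j)" .
  have "0 \<le> R"
    unfolding R_def
  proof (intro mult_nonneg_nonneg prod_nonneg)
    show "0 \<le> a j" if "j \<in> P \<inter> S" for j
      using that a S by blast
    show "0 \<le> 1 - a j" if "j \<in> {1..n} - (P \<union> S)" for j
      using that a[of j] by simp
  qed
  with le have "R * (prod a (P - S) * (\<Prod>j\<in>S - P. 1 - a j)) \<le> R * (prod a (S - P) * (\<Prod>j\<in>P - S. 1 - a j))"
    by (rule mult_left_mono)
  then show ?thesis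
    unfolding atom_prob_def P_def[symmetric] pP pS qP qS R_def by (simp only: mult_ac)
qed

text \<open>The two atoms differ only in the factors at \<open>j+1\<close> and \<open>j+2\<close>,
  and (1 - x)(1 - y) - xy = 1 - (x + y). So the sign of the change is decided by whether the two
  marginals sum to at most 1.\<close>

lemma atom_prob_initial_segment_diff:
  assumes "j + 2 \<le> n"
  shows "atom_prob a {1..n} {1..j} - atom_prob a {1..n} {1..j+2} =
    (1 - (a (j+1) + a (j+2))) * ((\<Prod>i\<in>{1..j}. a i) * (\<Prod>i\<in>{j+3..n}. 1 - a i))"
proof -
  have sets: "{1..n} - {1..j} = insert (j+1) (insert (j+2) {j+3..n})"
    "{1..n} - {1..j+2} = {j+3..n}" "{1..j+2} = insert (j+1) (insert (j+2) {1..j})"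
    using assms by auto
  define X where "X = (\<Prod>i\<in>{1..j}. a i)"
  define Y where "Y = (\<Prod>i\<in>{j+3..n}. 1 - a i)"
  have "atom_prob a {1..n} {1..j} = X * ((1 - a (j+1)) * ((1 - a (j+2)) * Y))"
    unfolding atom_prob_def sets(1) X_def Y_def by simp
  moreover have "atom_prob a {1..n} {1..j+2} = a (j+1) * (a (j+2) * X) * Y"
    unfolding atom_prob_def sets(2) unfolding sets(3) X_def Y_def by simp
  ultimately show ?thesis
    unfolding X_def[symmetric] Y_def[symmetric] by (simp add: algebra_simps)
qed

text \<open>\<open>P\<close> is downward closed, so it holds up to \<open>p\<close> and fails
  afterwards. Thus \<open>h\<close> descends to \<open>p\<close> and ascends from there.\<close>

lemma greatest_prefix_minimizes:
  fixes h :: "nat \<Rightarrow> real"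
  assumes p: "p = Max {p \<in> {0..M}. \<forall>i\<in>{1..p}. P i}"
    and anti: "\<And>i j. 1 \<le> i \<Longrightarrow> i \<le> j \<Longrightarrow> j \<le> M \<Longrightarrow> P j \<Longrightarrow> P i"
    and down: "\<And>i. i < M \<Longrightarrow> P (Suc i) \<Longrightarrow> h (Suc i) \<le> h i"
    and up: "\<And>i. i < M \<Longrightarrow> \<not> P (Suc i) \<Longrightarrow> h i \<le> h (Suc i)"
  shows "p \<le> M" and "\<And>i. i \<le> M \<Longrightarrow> h p \<le> h i"
proof -
  let ?A = "{p \<in> {0..M}. \<forall>i\<in>{1..p}. P i}"
  have fin: "finite ?A" and ne: "?A \<noteq> {}"
    by (simp, rule ex_in_conv[THEN iffD1], rule exI[of _ 0], simp)
  have greatest: "q \<le> p" if "q \<in> ?A" for q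
    using Max_ge[OF fin that] p by simp
  have "p \<in> ?A"
    using Max_in[OF fin ne] unfolding p[symmetric] .
  then have pM: "p \<le> M" and all: "\<And>i. 1 \<le> i \<Longrightarrow> i \<le> p \<Longrightarrow> P i"
    by auto
  show "p \<le> M" by (rule pM)
  have fails: "\<not> P i" if "p < i" "i \<le> M" for i
  proof
    assume "P i"
    have "P j" if "1 \<le> j" "j \<le> i" for j
      by (rule anti[OF that \<open>i \<le> M\<close> \<open>P i\<close>])
    then have "i \<in> ?A"
      using \<open>i \<le> M\<close> by simp
    then have "i \<le> p"
      by (rule greatest)
    with \<open>p < i\<close> show False by simp
  qed
  show "h p \<le> h i" if "i \<le> M" for i
  proof (cases "i \<le> p")
    case True
    then show ?thesis
    proof (induction rule: inc_induct)
      case (step i)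
      have "h (Suc i) \<le> h i"
        using step.hyps pM by (intro down all) simp_all
      with step.IH show ?case by linarith
    qed simp
  next
    case False
    then have "p \<le> i" by simp
    then show ?thesis using that
    proof (induction rule: dec_induct)
      case (step i)
      have "h i \<le> h (Suc i)"
        using step.hyps step.prems by (intro up fails) simp_all
      with step show ?case by linarith
    qed simp
  qed
qed

text \<open>\<open>c\<close> is the parity offset: 1 for odd sizes and \<open>p_index\<close>, 0 for
  even sizes and \<open>m_index\<close>. The exchange argument reduces all sets to initial segments,
  and unimodality in the length selects the best one.\<close>

lemma least_atom_initial_segment:
  fixes c n :: nat
  assumes mono: "mono_on {1..n} a" and a: "\<And>j. j \<in> {1..n} \<Longrightarrow> 0 \<le> a j \<and> a j \<le> 1"
    and c: "c \<le> 1" "c \<le> n"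
    and p: "p = Max {p \<in> {0..(n - c) div 2}. \<forall>i\<in>{1..p}. a (2 * i + c - 1) + a (2 * i + c) \<le> 1}"
  shows "2 * p + c \<le> n" and "least_atom a {1..n} (c = 1) (atom_prob a {1..n} {1..2 * p + c})"
proof -
  define M where "M = (n - c) div 2"
  define P where "P i \<longleftrightarrow> a (2 * i + c - 1) + a (2 * i + c) \<le> 1" for i
  define h where "h i = atom_prob a {1..n} {1..2 * i + c}" for i
  have anti: "P i" if "1 \<le> i" "i \<le> j" "j \<le> M" "P j" for i j
  proof -
    have "a (2 * i + c - 1) \<le> a (2 * j + c - 1)" "a (2 * i + c) \<le> a (2 * j + c)"
      using that c unfolding M_def by (auto intro!: mono_onD[OF mono])
    then show ?thesis
      using \<open>P j\<close> unfolding P_def by linarith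
  qed
  have step: "\<exists>R\<ge>0. h i - h (Suc i) = (1 - (a (2 * Suc i + c - 1) + a (2 * Suc i + c))) * R"
    if "i < M" for i
  proof -
    have le: "2 * i + c + 2 \<le> n"
      using that c unfolding M_def by auto
    then have "0 \<le> (\<Prod>j\<in>{1..2*i+c}. a j) * (\<Prod>j\<in>{2*i+c+3..n}. 1 - a j)"
      using a by (intro mult_nonneg_nonneg prod_nonneg) auto
    moreover note atom_prob_initial_segment_diff[OF le, of a]
    \<comment> \<open>The pair tested at \<open>Suc i\<close> consists of the two indices that
      lengthen the segment \<open>{1..2 * i + c}\<close>; the truncated subtraction does no harm
      there.\<close>
    moreover have idx: "2 * Suc i + c - 1 = 2 * i + c + 1" "2 * Suc i + c = 2 * i + c + 2"
      by simp_all
    ultimately show ?thesis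
      unfolding h_def idx(1) unfolding idx(2) by (intro exI conjI)
  qed
  have down: "h (Suc i) \<le> h i" if "i < M" "P (Suc i)" for i
  proof -
    obtain R where R: "0 \<le> R" "h i - h (Suc i) = (1 - (a (2 * Suc i + c - 1) + a (2 * Suc i + c))) * R"
      using step[OF \<open>i < M\<close>] by blast
    have "0 \<le> h i - h (Suc i)"
      unfolding R(2) using that(2) R(1) unfolding P_def by (intro mult_nonneg_nonneg) auto
    then show ?thesis by simp
  qed
  have up: "h i \<le> h (Suc i)" if "i < M" "\<not> P (Suc i)" for i
  proof -
    obtain R where R: "0 \<le> R" "h i - h (Suc i) = (1 - (a (2 * Suc i + c - 1) + a (2 * Suc i + c))) * R"
      using step[OF \<open>i < M\<close>] by blast
    have "h i - h (Suc i) \<le> 0"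
      unfolding R(2) using that(2) R(1) unfolding P_def by (intro mult_nonpos_nonneg) auto
    then show ?thesis by simp
  qed
  have p': "p = Max {p \<in> {0..M}. \<forall>i\<in>{1..p}. P i}"
    unfolding p M_def P_def ..
  have pM: "p \<le> M"
    by (rule greatest_prefix_minimizes(1)[where P = P and h = h, OF p']) (fact anti down up)+
  have hp: "h p \<le> h i" if "i \<le> M" for i
    by (rule greatest_prefix_minimizes(2)[where P = P and h = h, OF p' _ _ _ that]) (fact anti down up)+
  show le: "2 * p + c \<le> n"
    using pM c unfolding M_def by auto
  have "h p \<le> atom_prob a {1..n} S" if S: "S \<subseteq> {1..n}" "odd (card S) = (c = 1)" for S
  proof -
    have "card S \<le> n"
      using card_mono[OF _ S(1)] by simp
    \<comment> \<open>The parity of \<open>card S\<close> is that of \<open>c\<close>, so the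
      segment of the same size is one of those measured by \<open>h\<close>.\<close>
    moreover obtain s where s: "card S = 2 * s + c"
      using S(2) c(1) by (cases "c = 1") (auto elim!: oddE evenE simp: le_Suc_eq)
    ultimately have "s \<le> M"
      unfolding M_def by simp
    then have "h p \<le> h s"
      by (rule hp)
    also have "\<dots> = atom_prob a {1..n} {1..card S}"
      unfolding h_def s ..
    also have "\<dots> \<le> atom_prob a {1..n} S"
      by (rule atom_prob_initial_segment_le[OF mono a S(1)])
    finally show ?thesis .
  qed
  moreover have "odd (card {1..2 * p + c}) = (c = 1)"
    using c by (cases "c = 1") (auto simp: le_Suc_eq)
  moreover have "{1..2 * p + c} \<subseteq> {1..n}"
    using le by simp
  ultimately show "least_atom a {1..n} (c = 1) (atom_prob a {1..n} {1..2 * p + c})"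
    unfolding least_atom_def h_def by blast
qed

lemma least_atom_alpha:
  assumes "mono_on {1..n} a" and "\<And>j. j \<in> {1..n} \<Longrightarrow> 0 \<le> a j \<and> a j \<le> 1" and "1 \<le> n"
  shows "least_atom a {1..n} True (alpha n a)"
proof -
  have p: "p_index n a = Max {p \<in> {0..(n - 1) div 2}. \<forall>i\<in>{1..p}. a (2 * i + 1 - 1) + a (2 * i + 1) \<le> 1}"
    unfolding p_index_def by simp
  note l = least_atom_initial_segment[where c = 1, OF assms(1,2) _ _ p]
  have "{1..n} - {1..2 * p_index n a + 1} = {2 * p_index n a + 2..n}"
    by auto
  then show ?thesis
    using l(2) assms(3) by (simp add: alpha_def atom_prob_def)
qed

lemma least_atom_beta:
  assumes "mono_on {1..n} a" and "\<And>j. j \<in> {1..n} \<Longrightarrow> 0 \<le> a j \<and> a j \<le> 1"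
  shows "least_atom a {1..n} False (beta n a)"
proof -
  have p: "m_index n a = Max {p \<in> {0..(n - 0) div 2}. \<forall>i\<in>{1..p}. a (2 * i + 0 - 1) + a (2 * i + 0) \<le> 1}"
    unfolding m_index_def by simp
  note l = least_atom_initial_segment[where c = 0, OF assms(1,2) _ _ p]
  have "{1..n} - {1..2 * m_index n a} = {2 * m_index n a + 1..n}"
    by auto
  then show ?thesis
    using l(2) by (simp add: beta_def atom_prob_def)
qed

section \<open>Joint distributions of \<open>(n - 1)\<close>-wise independent events\<close>

lemma signed_card_ge_sum:
  assumes "\<And>S. S \<subseteq> {1..n} \<Longrightarrow> q S = atom_prob a {1..n} S + (-1) ^ card S * d"
    and "1 \<le> k" "1 \<le> n"
  shows "(\<Sum>J\<in>Pow {1..n}. if k \<le> card J then q J else 0) =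
    indep_prob_at_least n k a + (-1) ^ k * real ((n - 1) choose (k - 1)) * d"
proof -
  have "(\<Sum>J\<in>Pow {1..n}. if k \<le> card J then q J else 0) =
      (\<Sum>J\<in>Pow {1..n}. (if k \<le> card J then atom_prob a {1..n} J else 0)
        + (if k \<le> card J then (-1) ^ card J else 0) * d)"
    by (rule sum.cong) (auto simp: assms(1))
  also have "\<dots> = indep_prob_at_least n k a
      + (\<Sum>J\<in>Pow {1..n}. if k \<le> card J then (-1) ^ card J else 0) * d"
    by (simp only: sum.distrib indep_prob_at_least_eq sum_distrib_right)
  also have "(\<Sum>J\<in>Pow {1..n}. if k \<le> card J then (-1) ^ card J else 0) =
      (-1) ^ k * real ((n - 1) choose (k - 1))"
    using sum_sign_card_ge[of "{1..n}" k] assms(2,3) by simp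
  finally show ?thesis .
qed

section \<open>Cells cut out by the events, and their probabilities\<close>

definition cell :: "'w measure \<Rightarrow> (nat \<Rightarrow> 'w set) \<Rightarrow> nat set \<Rightarrow> nat set \<Rightarrow> 'w set" where
  "cell M A N S = {\<omega> \<in> space M. \<forall>i\<in>N. \<omega> \<in> A i \<longleftrightarrow> i \<in> S}"

text \<open>\<open>N\<close> must be nonempty, since the empty intersection is \<open>UNIV\<close>
  rather than \<open>space M\<close>.\<close>

lemma cell_eq_INT:
  assumes "\<And>i. i \<in> N \<Longrightarrow> A i \<in> sets M" and "N \<noteq> {}"
  shows "cell M A N S = (\<Inter>i\<in>N. if i \<in> S then A i else space M - A i)"
proof (intro equalityI subsetI)
  fix \<omega> assume \<omega>: "\<omega> \<in> (\<Inter>i\<in>N. if i \<in> S then A i else space M - A i)"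
  have each: "\<omega> \<in> space M \<and> (\<omega> \<in> A i \<longleftrightarrow> i \<in> S)" if "i \<in> N" for i
    using INT_D[OF \<omega> that] sets.sets_into_space[OF assms(1)[OF that]] by (cases "i \<in> S") auto
  with assms(2) show "\<omega> \<in> cell M A N S"
    unfolding cell_def by blast
qed (auto simp: cell_def)

lemma cell_in_sets:
  assumes "\<And>i. i \<in> N \<Longrightarrow> A i \<in> sets M" and "N \<noteq> {}" and "finite N"
  shows "cell M A N S \<in> sets M"
proof -
  have "(\<Inter>i\<in>N. if i \<in> S then A i else space M - A i) \<in> sets M"
    using assms by (intro sets.finite_INT) auto
  then show ?thesis
    using assms(1,2) by (subst cell_eq_INT)
qed

text \<open>Independence of the events extends to the sigma-algebras they generate, which also
  contain the complements; the cell is an intersection of such sets.\<close>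

lemma (in prob_space) prob_cell:
  assumes indep: "indep_events A J" and J: "finite J" "J \<noteq> {}" and S: "S \<subseteq> J"
    and a: "\<And>i. i \<in> J \<Longrightarrow> prob (A i) = a i"
  shows "prob (cell M A J S) = atom_prob a J S"
proof -
  let ?B = "\<lambda>i. if i \<in> S then A i else space M - A i"
  have ev: "A i \<in> events" if "i \<in> J" for i
    using indep that by (auto simp: indep_events_def)
  have "indep_sets (\<lambda>i. sigma_sets (space M) {A i}) J"
    using indep unfolding indep_events_def_alt
    by (rule indep_sets_sigma) (auto simp: Int_stable_def)
  then have "prob (\<Inter>i\<in>J. ?B i) = (\<Prod>i\<in>J. prob (?B i))"
    by (rule indep_setsD) (use J in \<open>auto intro: sigma_sets.intros\<close>)
  also have "\<dots> = (\<Prod>i\<in>J. if i \<in> S then a i else 1 - a i)"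
    by (rule prod.cong) (auto simp: a ev prob_compl)
  also have "\<dots> = atom_prob a J S"
    using J(1) S by (simp add: prod.If_cases atom_prob_def Int_absorb1 Int_commute Diff_eq)
  finally show ?thesis
    using cell_eq_INT[of J A M S] ev J by simp
qed

text \<open>Merging the two cells that differ only in \<open>A\<^sub>x\<close> gives a cell of the \<open>n - 1\<close> independent
  events \<open>A\<^sub>i\<close>, \<open>i \<noteq> x\<close>. So the deviation of a cell from its product value changes sign when an
  index is added.\<close>

lemma (in prob_space) cell_deviation:
  assumes n: "2 \<le> n" and ev: "\<And>i. i \<in> {1..n} \<Longrightarrow> A i \<in> events"
    and a: "\<And>i. i \<in> {1..n} \<Longrightarrow> prob (A i) = a i"
    and indep: "n_minus_1_wise_indep M n A" and S: "S \<subseteq> {1..n}"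
  shows "prob (cell M A {1..n} S) = atom_prob a {1..n} S
    + (-1) ^ card S * (prob (cell M A {1..n} {}) - atom_prob a {1..n} {})"
proof -
  let ?N = "{1..n}"
  have pair: "prob (cell M A ?N R) + prob (cell M A ?N (insert x R)) =
      atom_prob a ?N R + atom_prob a ?N (insert x R)"
    if x: "x \<in> ?N" and R: "R \<subseteq> ?N" "x \<notin> R" for x R
  proof -
    let ?J = "?N - {x}"
    have J: "finite ?J" "?J \<noteq> {}" "card ?J = n - 1"
    proof -
      show "card ?J = n - 1" using x by (simp add: card_Diff_singleton)
      \<comment> \<open>This is where \<open>2 \<le> n\<close> is needed: removing one index leaves
        at least one event.\<close>
      then show "?J \<noteq> {}" using n by (intro notI) (simp only: card.empty)
    qed simp
    have sub: "R \<subseteq> ?J" using R by auto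
    have N: "?N = insert x ?J" using x by auto
    have "indep_events A ?J"
      using indep J unfolding n_minus_1_wise_indep_def by auto
    then have "prob (cell M A ?J R) = atom_prob a ?J R"
      by (rule prob_cell) (use J sub a in auto)
    moreover have "cell M A ?J R = cell M A ?N R \<union> cell M A ?N (insert x R)"
      using x R unfolding cell_def by blast
    moreover have "cell M A ?N R \<inter> cell M A ?N (insert x R) = {}"
      using x R unfolding cell_def by blast
    moreover have "cell M A ?N T \<in> events" for T
      using ev x by (intro cell_in_sets) auto
    ultimately have "prob (cell M A ?N R) + prob (cell M A ?N (insert x R)) = atom_prob a ?J R"
      by (metis finite_measure_Union)
    also have "\<dots> = atom_prob a ?N R + atom_prob a ?N (insert x R)"
      using atom_prob_insert[OF J(1) _ sub, of x a] N[symmetric] by (simp add: algebra_simps)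
    finally show ?thesis .
  qed
  have "finite S"
    using S finite_subset by auto
  then show ?thesis using S
  proof (induction S)
    case (insert x S)
    then have "prob (cell M A ?N S) + prob (cell M A ?N (insert x S)) =
        atom_prob a ?N S + atom_prob a ?N (insert x S)"
      by (intro pair) auto
    moreover have "prob (cell M A ?N S) = atom_prob a ?N S
        + (-1) ^ card S * (prob (cell M A ?N {}) - atom_prob a ?N {})"
      using insert by blast
    moreover have "card (insert x S) = Suc (card S)"
      using insert by simp
    ultimately show ?case
  by (simp only: power_Suc)
  qed simp
qed

text \<open>Each sample point lies in exactly one cell, indexed by the set of events containing it,
  so the event is a disjoint union of cells.\<close>

lemma (in prob_space) prob_card_ge:
  assumes "1 \<le> n" and ev: "\<And>i. i \<in> {1..n} \<Longrightarrow> A i \<in> events"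
  shows "prob {\<omega> \<in> space M. k \<le> card {i \<in> {1..n}. \<omega> \<in> A i}} =
    (\<Sum>J\<in>Pow {1..n}. if k \<le> card J then prob (cell M A {1..n} J) else 0)"
proof -
  let ?N = "{1..n}"
  have cell_iff: "\<omega> \<in> cell M A ?N J \<longleftrightarrow> \<omega> \<in> space M \<and> J = {i \<in> ?N. \<omega> \<in> A i}" if "J \<subseteq> ?N" for J \<omega>
    using that unfolding cell_def by auto
  have "{\<omega> \<in> space M. k \<le> card {i \<in> ?N. \<omega> \<in> A i}} =
      (\<Union>J\<in>{J. J \<subseteq> ?N \<and> k \<le> card J}. cell M A ?N J)"
  proof (intro set_eqI iffI)
    fix \<omega> assume "\<omega> \<in> {\<omega> \<in> space M. k \<le> card {i \<in> ?N. \<omega> \<in> A i}}"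
    then show "\<omega> \<in> (\<Union>J\<in>{J. J \<subseteq> ?N \<and> k \<le> card J}. cell M A ?N J)"
      by (intro UN_I[of "{i \<in> ?N. \<omega> \<in> A i}"]) (auto simp: cell_def)
  next
    fix \<omega> assume "\<omega> \<in> (\<Union>J\<in>{J. J \<subseteq> ?N \<and> k \<le> card J}. cell M A ?N J)"
    then obtain J where "J \<subseteq> ?N" "k \<le> card J" "\<omega> \<in> cell M A ?N J" by blast
    with cell_iff[of J \<omega>] show "\<omega> \<in> {\<omega> \<in> space M. k \<le> card {i \<in> ?N. \<omega> \<in> A i}}"
      by simp
  qed
  also have "prob \<dots> = (\<Sum>J | J \<subseteq> ?N \<and> k \<le> card J. prob (cell M A ?N J))"
  proof (rule finite_measure_finite_Union)
    show "cell M A ?N ` {J. J \<subseteq> ?N \<and> k \<le> card J} \<subseteq> events"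
    proof (rule image_subsetI)
      show "cell M A ?N J \<in> events" for J
        using ev \<open>1 \<le> n\<close> by (intro cell_in_sets) simp_all
    qed
    show "disjoint_family_on (cell M A ?N) {J. J \<subseteq> ?N \<and> k \<le> card J}"
      unfolding disjoint_family_on_def
    proof (intro ballI impI)
      fix J K assume "J \<in> {J. J \<subseteq> ?N \<and> k \<le> card J}" "K \<in> {J. J \<subseteq> ?N \<and> k \<le> card J}" "J \<noteq> K"
      then show "cell M A ?N J \<inter> cell M A ?N K = {}"
        using cell_iff[of J] cell_iff[of K] by auto
    qed
  qed simp
  also have "\<dots> = (\<Sum>J\<in>Pow ?N. if k \<le> card J then prob (cell M A ?N J) else 0)"
    by (rule sum_card_ge) simp
  finally show ?thesis .
qed

text \<open>\<open>d\<close> is the deviation of the empty cell. Nonnegativity of the cell at a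
  least odd atom bounds it above, and at a least even atom bounds it below.\<close>

lemma attainable_probsD:
  assumes n: "2 \<le> n" and k: "1 \<le> k" and x: "x \<in> attainable_probs TYPE('w) n k a"
    and \<alpha>: "least_atom a {1..n} True \<alpha>" and \<beta>: "least_atom a {1..n} False \<beta>"
  obtains d where "- \<beta> \<le> d" "d \<le> \<alpha>"
    "x = indep_prob_at_least n k a + (-1) ^ k * real ((n - 1) choose (k - 1)) * d"
proof -
  obtain M :: "'w measure" and A where M: "prob_space M"
    and A: "\<And>i. i \<in> {1..n} \<Longrightarrow> A i \<in> sets M" "\<And>i. i \<in> {1..n} \<Longrightarrow> measure M (A i) = a i"
    and indep: "n_minus_1_wise_indep M n A"
    and xM: "x = measure M {\<omega> \<in> space M. k \<le> card {i \<in> {1..n}. \<omega> \<in> A i}}"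
    using x unfolding attainable_probs_def by blast
  interpret prob_space M by (rule M)
  define d where "d = prob (cell M A {1..n} {}) - atom_prob a {1..n} {}"
  have q: "prob (cell M A {1..n} S) = atom_prob a {1..n} S + (-1) ^ card S * d" if "S \<subseteq> {1..n}" for S
    unfolding d_def by (rule cell_deviation[OF n A indep that])
  have "x = indep_prob_at_least n k a + (-1) ^ k * real ((n - 1) choose (k - 1)) * d"
  proof -
    have "1 \<le> n" using n by simp
    then have "x = (\<Sum>J\<in>Pow {1..n}. if k \<le> card J then prob (cell M A {1..n} J) else 0)"
      unfolding xM using A(1) by (rule prob_card_ge)
    also have "\<dots> = indep_prob_at_least n k a + (-1) ^ k * real ((n - 1) choose (k - 1)) * d"
      using q k \<open>1 \<le> n\<close> by (rule signed_card_ge_sum)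
    finally show ?thesis .
  qed
  moreover have "d \<le> \<alpha>"
  proof -
    obtain S where S: "S \<subseteq> {1..n}" "odd (card S)" "\<alpha> = atom_prob a {1..n} S"
      using \<alpha> unfolding least_atom_def by auto
    then show ?thesis
      using q[OF S(1)] measure_nonneg[of M "cell M A {1..n} S"] by simp
  qed
  moreover have "- \<beta> \<le> d"
  proof -
    obtain S where S: "S \<subseteq> {1..n}" "even (card S)" "\<beta> = atom_prob a {1..n} S"
      using \<beta> unfolding least_atom_def by auto
    then show ?thesis
      using q[OF S(1)] measure_nonneg[of M "cell M A {1..n} S"] by simp
  qed
  ultimately show ?thesis using that by blast
qed

text \<open>The converse by construction: the sample points are the subsets of
  \<open>{1..n}\<close>, \<open>S\<close> gets mass \<open>q S\<close>, and \<open>A i\<close>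
  collects the subsets containing \<open>i\<close>. The bounds on \<open>d\<close> make all masses
  nonnegative.\<close>

lemma attainable_probsI:
  assumes n: "2 \<le> n" and k: "1 \<le> k"
    and \<alpha>: "least_atom a {1..n} True \<alpha>" and \<beta>: "least_atom a {1..n} False \<beta>"
    and d: "- \<beta> \<le> d" "d \<le> \<alpha>"
  shows "indep_prob_at_least n k a + (-1) ^ k * real ((n - 1) choose (k - 1)) * d
    \<in> attainable_probs TYPE(nat set) n k a"
proof -
  let ?N = "{1..n}"
  define q where "q S = atom_prob a ?N S + (-1) ^ card S * d" for S
  define M where "M = point_measure (Pow ?N) (\<lambda>S. ennreal (q S))"
  define A where "A i = {S. i \<in> S \<and> S \<subseteq> ?N}" for i
  have q_nonneg: "0 \<le> q S" if "S \<subseteq> ?N" for S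
  proof (cases "odd (card S)")
    case True
    with that \<alpha> have "\<alpha> \<le> atom_prob a ?N S"
      unfolding least_atom_def by auto
    with True d show ?thesis by (simp add: q_def)
  next
    case False
    with that \<beta> have "\<beta> \<le> atom_prob a ?N S"
      unfolding least_atom_def by auto
    with False d show ?thesis by (simp add: q_def)
  qed
  \<comment> \<open>Properness of \<open>K\<close> kills the sign sum, so the perturbation by
    \<open>d\<close> is invisible here. The case \<open>K = {}\<close> below gives total mass
    1.\<close>
  have q_supersets: "(\<Sum>S | K \<subseteq> S \<and> S \<subseteq> ?N. q S) = prod a K" if "K \<subset> ?N" for K
    unfolding q_def sum.distrib sum_distrib_right[symmetric]
    using that sum_supersets_atom_prob[of ?N K a] sum_supersets_sign[of ?N K] by simp
  have space: "space M = Pow ?N" and sets: "sets M = Pow (Pow ?N)"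
    unfolding M_def by (simp_all add: space_point_measure sets_point_measure)
  have emeasure: "emeasure M X = ennreal (sum q X)" if "X \<subseteq> Pow ?N" for X
    unfolding M_def using that q_nonneg
    by (subst emeasure_point_measure_finite) (auto intro!: sum_ennreal)
  have prob: "measure M X = sum q X" if "X \<subseteq> Pow ?N" for X
    using emeasure[OF that] that q_nonneg by (intro measure_eq_emeasure_eq_ennreal sum_nonneg) auto
  have "{} \<subset> ?N"
    using n by (simp add: psubset_eq)
  then have "sum q (Pow ?N) = 1"
    using q_supersets[of "{}"] by (simp add: Pow_def)
  then have "emeasure M (space M) = 1"
    using emeasure[of "Pow ?N"] by (simp add: space)
  then interpret prob_space M
    by (rule prob_spaceI)
  have A_sets: "A i \<in> events" for i
    unfolding sets A_def by auto
  have A_Inter: "prob (\<Inter>i\<in>K. A i) = prod a K" if "K \<subset> ?N" "K \<noteq> {}" for K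
  proof -
    have "(\<Inter>i\<in>K. A i) = {S. K \<subseteq> S \<and> S \<subseteq> ?N}"
      using that(2) unfolding A_def by auto
    then show ?thesis
      using prob[of "\<Inter>i\<in>K. A i"] q_supersets[OF that(1)] by auto
  qed
  have A_prob: "prob (A i) = a i" if "i \<in> ?N" for i
  proof -
    \<comment> \<open>With at least two events a singleton is a proper subset, so the perturbation
      also preserves the marginals.\<close>
    have "{i} \<noteq> ?N"
    proof
      assume eq: "{i} = ?N"
      have "1 \<in> {i}" "2 \<in> {i}"
        unfolding eq using n by auto
      then show False by simp
    qed
    with that have "{i} \<subset> ?N" by blast
    then show ?thesis
      using A_Inter[of "{i}"] by simp
  qed
  have indep: "n_minus_1_wise_indep M n A"
    unfolding n_minus_1_wise_indep_def
  proof (intro allI impI)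
    fix J assume J: "J \<subseteq> ?N \<and> card J = n - 1"
    with n have "J \<noteq> ?N" by auto
    with J have J': "J \<subset> ?N" by auto
    show "indep_events A J"
      unfolding indep_events_def
    proof (intro conjI allI impI)
      fix K assume "K \<subseteq> J" "K \<noteq> {}"
      then have "prob (\<Inter>i\<in>K. A i) = prod a K"
        using J' by (intro A_Inter) auto
      also have "\<dots> = (\<Prod>i\<in>K. prob (A i))"
        using \<open>K \<subseteq> J\<close> J by (intro prod.cong) (auto simp: A_prob)
      finally show "prob (\<Inter>i\<in>K. A i) = (\<Prod>i\<in>K. prob (A i))" .
    qed (use A_sets in auto)
  qed
  have prob_value: "prob {\<omega> \<in> space M. k \<le> card {i \<in> ?N. \<omega> \<in> A i}} =
      indep_prob_at_least n k a + (-1) ^ k * real ((n - 1) choose (k - 1)) * d"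
  proof -
    have "{i \<in> ?N. \<omega> \<in> A i} = \<omega>" if "\<omega> \<in> Pow ?N" for \<omega>
      using that unfolding A_def by auto
    then have "k \<le> card {i \<in> ?N. \<omega> \<in> A i} \<longleftrightarrow> k \<le> card \<omega>" if "\<omega> \<subseteq> ?N" for \<omega>
      using that by (simp only: Pow_iff)
    then have event: "{\<omega> \<in> space M. k \<le> card {i \<in> ?N. \<omega> \<in> A i}} = {J. J \<subseteq> ?N \<and> k \<le> card J}"
      unfolding space by (auto cong: conj_cong)
    have "{J. J \<subseteq> ?N \<and> k \<le> card J} \<subseteq> Pow ?N"
      by blast
    then have "prob {\<omega> \<in> space M. k \<le> card {i \<in> ?N. \<omega> \<in> A i}} = (\<Sum>J | J \<subseteq> ?N \<and> k \<le> card J. q J)"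
      unfolding event by (rule prob)
    also have "\<dots> = (\<Sum>J\<in>Pow ?N. if k \<le> card J then q J else 0)"
      by (rule sum_card_ge) simp
    also have "\<dots> = indep_prob_at_least n k a + (-1) ^ k * real ((n - 1) choose (k - 1)) * d"
      by (rule signed_card_ge_sum) (use n k in \<open>simp_all add: q_def\<close>)
    finally show ?thesis .
  qed
  have "prob_space M"
    by unfold_locales
  moreover have "\<forall>i\<in>?N. A i \<in> events \<and> prob (A i) = a i"
    using A_sets A_prob by blast
  ultimately show ?thesis
    unfolding attainable_probs_def using prob_value[symmetric] indep
    by (intro CollectI exI[of _ M] exI[of _ A] conjI)
qed

section \<open>The program\<close>

primrec straight_line :: "com \<Rightarrow> bool" where
  "straight_line Skip \<longleftrightarrow> True"
| "straight_line (IAssign x e) \<longleftrightarrow> True"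
| "straight_line (RAssign x e f) \<longleftrightarrow> True"
| "straight_line (Seq c d) \<longleftrightarrow> straight_line c \<and> straight_line d"
| "straight_line (Cond b c d) \<longleftrightarrow> straight_line c \<and> straight_line d"
| "straight_line (While b c) \<longleftrightarrow> False"

text \<open>A functional semantics for loop-free code, so that simplification can run it. The
  \<open>While\<close> clauses here and in \<open>max_cost\<close> are placeholders, excluded by
  \<open>straight_line\<close>.\<close>

primrec exec :: "com \<Rightarrow> state \<Rightarrow> state" where
  "exec Skip s = s"
| "exec (IAssign x e) s = ((fst s)(x := ival e s), snd s)"
| "exec (RAssign x e f) s = (fst s, (snd s)(x := (snd s x)(ival e s := rval f s)))"
| "exec (Seq c d) s = exec d (exec c s)"
| "exec (Cond b c d) s = (if bval b s then exec c s else exec d s)"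
| "exec (While b c) s = s"

primrec max_cost :: "com \<Rightarrow> nat" where
  "max_cost Skip = 1"
| "max_cost (IAssign x e) = icost e + 1"
| "max_cost (RAssign x e f) = icost e + rcost f + 1"
| "max_cost (Seq c d) = max_cost c + max_cost d"
| "max_cost (Cond b c d) = bcost b + 1 + max (max_cost c) (max_cost d)"
| "max_cost (While b c) = 0"

definition runs_within :: "com \<Rightarrow> state \<Rightarrow> nat \<Rightarrow> state \<Rightarrow> bool" where
  "runs_within c s T s' \<longleftrightarrow> (\<exists>t\<le>T. runs c s t s')"

lemma runs_within_Seq:
  assumes "runs_within c s T s'" and "runs_within d s' T' s''"
  shows "runs_within (Seq c d) s (T + T') s''"
  using assms unfolding runs_within_def by (metis add_mono runs.Seq)

lemma runs_within_exec: "straight_line c \<Longrightarrow> runs_within c s (max_cost c) (exec c s)"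
proof (induction c arbitrary: s)
  case Skip
  show ?case unfolding runs_within_def using runs.Skip[of s] by (intro exI[of _ 1]) simp
next
  case (IAssign x e)
  show ?case using runs.IAssign[of x e "fst s" "snd s"] by (auto simp: runs_within_def)
next
  case (RAssign x e f)
  show ?case using runs.RAssign[of x e f "fst s" "snd s"] by (auto simp: runs_within_def)
next
  case (Seq c d)
  then show ?case
    using runs_within_Seq[OF Seq.IH(1)[of s] Seq.IH(2)[of "exec c s"]] by simp
next
  case (Cond b c d)
  show ?case
  proof (cases "bval b s")
    case True
    obtain t where "t \<le> max_cost c" "runs c s t (exec c s)"
      using Cond.IH(1)[of s] Cond.prems unfolding runs_within_def by auto
    with True show ?thesis
      by (auto simp: runs_within_def intro!: exI[of _ "bcost b + 1 + t"] runs.CondTrue[simplified])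
  next
    case False
    obtain t where "t \<le> max_cost d" "runs d s t (exec d s)"
      using Cond.IH(2)[of s] Cond.prems unfolding runs_within_def by auto
    with False show ?thesis
      by (auto simp: runs_within_def intro!: exI[of _ "bcost b + 1 + t"] runs.CondFalse[simplified])
  qed
next
  case (While b c)
  then show ?case by simp
qed

text \<open>Each round lowers \<open>m\<close>, so there are at most \<open>m s\<close> rounds; the
  extra summand 1 pays for the final failing test.\<close>

lemma runs_within_While:
  fixes m :: "state \<Rightarrow> nat"
  assumes step: "\<And>s. I s \<Longrightarrow> bval b s \<Longrightarrow> \<exists>s'. runs_within c s K s' \<and> I s' \<and> m s' < m s"
    and init: "I s"
  shows "\<exists>s'. runs_within (While b c) s ((m s + 1) * (bcost b + 1 + K)) s' \<and> I s' \<and> \<not> bval b s'"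
  using init
proof (induction "m s" arbitrary: s rule: less_induct)
  case less
  show ?case
  proof (cases "bval b s")
    case False
    then have "runs_within (While b c) s ((m s + 1) * (bcost b + 1 + K)) s"
      unfolding runs_within_def by (intro exI[of _ "bcost b + 1"]) (simp add: runs.WhileFalse[simplified])
    with False less.prems show ?thesis by blast
  next
    case True
    obtain s' where s': "runs_within c s K s'" "I s'" "m s' < m s"
      using step[OF less.prems True] by blast
    obtain s'' where s'': "runs_within (While b c) s' ((m s' + 1) * (bcost b + 1 + K)) s''"
      "I s''" "\<not> bval b s''"
      using less.hyps[OF s'(3,2)] by blast
    obtain t where t: "t \<le> K" "runs c s t s'"
      using s'(1) unfolding runs_within_def by blast
    obtain t' where t': "t' \<le> (m s' + 1) * (bcost b + 1 + K)" "runs (While b c) s' t' s''"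
      using s''(1) unfolding runs_within_def by blast
    have "bcost b + 1 + t + t' \<le> (bcost b + 1 + K) + (m s' + 1) * (bcost b + 1 + K)"
      using t(1) t'(1) by linarith
    also have "\<dots> = (m s' + 2) * (bcost b + 1 + K)"
      by simp
    also have "\<dots> \<le> (m s + 1) * (bcost b + 1 + K)"
      using s'(3) by (intro mult_right_mono) auto
    finally show ?thesis
      using runs.WhileTrue[OF True t(2) t'(2)] s''(2,3) unfolding runs_within_def by blast
  qed
qed

section \<open>The program text\<close>

abbreviation at_i :: "name \<Rightarrow> rexp" where
  "at_i x \<equiv> RCell x (IVar ''i'')"

abbreviation at_j :: "name \<Rightarrow> rexp" where
  "at_j x \<equiv> RCell x (IVar ''j'')"

abbreviation at_pred_j :: "name \<Rightarrow> rexp" where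
  "at_pred_j x \<equiv> RCell x (ISub (IVar ''j'') (IConst 1))"

text \<open>Real memory consists of arrays only, so cell 0 of an array serves as a real
  variable.\<close>

abbreviation scalar :: "name \<Rightarrow> rexp" where
  "scalar x \<equiv> RCell x (IConst 0)"

abbreviation set_scalar :: "name \<Rightarrow> rexp \<Rightarrow> com" where
  "set_scalar x e \<equiv> RAssign x (IConst 0) e"

abbreviation compl_a :: rexp where
  "compl_a \<equiv> RSub (RConst 1) (at_i ''a'')"

abbreviation set_min :: "name \<Rightarrow> rexp \<Rightarrow> rexp \<Rightarrow> com" where
  "set_min x e f \<equiv> Cond (RLe e f) (set_scalar x e) (set_scalar x f)"

text \<open>When \<open>i\<close> events have been read, \<open>E\<close> and \<open>O\<close> hold the least probabilities of an even and of
  an odd atom of these events; \<open>T\<close> and \<open>D\<close> lag one event behind and hold the tail probabilities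
  \<open>P\<^sub>0(i - 1, l, a)\<close> and the signed binomials \<open>(-1)\<^sup>l (i - 1 choose l)\<close>. The sign in \<open>D\<close> lets the
  output treat both parities of \<open>k\<close> alike, by sorting the two end points.\<close>

definition row_body :: com where
  "row_body =
     Seq (RAssign ''T'' (IVar ''j'')
       (RAdd (RMul (at_i ''a'') (at_pred_j ''T'')) (RMul compl_a (at_j ''T''))))
    (Seq (RAssign ''D'' (IVar ''j'') (RSub (at_j ''D'') (at_pred_j ''D'')))
     (IAssign ''j'' (ISub (IVar ''j'') (IConst 1))))"

definition row_loop :: com where
  "row_loop = While (ILe (IConst 1) (IVar ''j'')) row_body"

text \<open>\<open>W\<close> saves the old \<open>E\<close>, which the update of \<open>O\<close>
  still needs after \<open>E\<close> has been overwritten.\<close>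

definition step_minima :: com where
  "step_minima =
     Seq (IAssign ''i'' (IAdd (IVar ''i'') (IConst 1)))
    (Seq (set_scalar ''W'' (scalar ''E''))
    (Seq (set_min ''E'' (RMul (scalar ''E'') compl_a) (RMul (scalar ''O'') (at_i ''a'')))
      (set_min ''O'' (RMul (scalar ''O'') compl_a) (RMul (scalar ''W'') (at_i ''a'')))))"

definition outer_loop :: com where
  "outer_loop = While (BNot (ILe (IVar ''n'') (IVar ''i'')))
     (Seq (IAssign ''j'' (IVar ''n'')) (Seq row_loop step_minima))"

text \<open>As the remaining memory is 0, setting cell 0 of \<open>T\<close> and \<open>D\<close> to
  1 produces the rows for zero events. \<open>E\<close> and \<open>O\<close> start with the first
  event already read.\<close>

definition initialize :: com where
  "initialize =
     Seq (IAssign ''i'' (IConst 1))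
    (Seq (set_scalar ''T'' (RConst 1))
    (Seq (set_scalar ''D'' (RConst 1))
    (Seq (set_scalar ''E'' compl_a)
      (set_scalar ''O'' (at_i ''a'')))))"

abbreviation at_k :: "name \<Rightarrow> rexp" where
  "at_k x \<equiv> RCell x (IVar ''k'')"

abbreviation at_pred_k :: "name \<Rightarrow> rexp" where
  "at_pred_k x \<equiv> RCell x (ISub (IVar ''k'') (IConst 1))"

text \<open>\<open>T\<close> holds the row for \<open>n - 1\<close> events, so one more recurrence
  step, at column \<open>k\<close> only, yields \<open>P\<close>. \<open>X\<close> and
  \<open>Y\<close> are the values at the end points of the range of \<open>d\<close>: the least odd
  atom and minus the least even atom.\<close>

definition output_bounds :: com where
  "output_bounds =
     Seq (set_scalar ''P'' (RAdd (RMul (at_i ''a'') (at_pred_k ''T'')) (RMul compl_a (at_k ''T''))))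
    (Seq (set_scalar ''X'' (RSub (scalar ''P'') (RMul (at_pred_k ''D'') (scalar ''O''))))
    (Seq (set_scalar ''Y'' (RAdd (scalar ''P'') (RMul (at_pred_k ''D'') (scalar ''E''))))
     (Cond (RLe (scalar ''X'') (scalar ''Y''))
       (Seq (set_scalar ''L'' (scalar ''X'')) (set_scalar ''U'' (scalar ''Y'')))
       (Seq (set_scalar ''L'' (scalar ''Y'')) (set_scalar ''U'' (scalar ''X''))))))"

definition bounds_program :: com where
  "bounds_program = Seq initialize (Seq outer_loop output_bounds)"

section \<open>Correctness and running time of the program\<close>

definition signed_choose :: "nat \<Rightarrow> nat \<Rightarrow> real" where
  "signed_choose m l = (-1) ^ l * real (m choose l)"

lemma signed_choose_Suc: "signed_choose (Suc m) (Suc l) = signed_choose m (Suc l) - signed_choose m l"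
  by (simp add: signed_choose_def algebra_simps)

lemma indep_prob_at_least_0: "indep_prob_at_least n 0 a = 1"
  using sum_supersets_atom_prob[of "{1..n}" "{}" a] by (simp add: indep_prob_at_least_eq Pow_def)

lemma indep_prob_at_least_no_events: "indep_prob_at_least 0 k a = (if k = 0 then 1 else 0)"
  by (simp add: indep_prob_at_least_eq atom_prob_def)

definition frame :: "nat \<Rightarrow> nat \<Rightarrow> (nat \<Rightarrow> real) \<Rightarrow> state \<Rightarrow> bool" where
  "frame n k a s \<longleftrightarrow> fst s ''n'' = n \<and> fst s ''k'' = k \<and> (\<forall>i\<in>{1..n}. snd s ''a'' i = a i)"

text \<open>The rows are overwritten from right to left: entries beyond \<open>j\<close> already belong to row
  \<open>m + 1\<close>, the others still to row \<open>m\<close>.\<close>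

definition dp_rows :: "nat \<Rightarrow> (nat \<Rightarrow> real) \<Rightarrow> nat \<Rightarrow> nat \<Rightarrow> state \<Rightarrow> bool" where
  "dp_rows n a m j s \<longleftrightarrow> (\<forall>l\<le>n.
     snd s ''T'' l = indep_prob_at_least (if j < l then Suc m else m) l a \<and>
     snd s ''D'' l = signed_choose (if j < l then Suc m else m) l)"

text \<open>Column 0 is 1 in every row of both tables, so it never needs an update and the loop may
  stop at \<open>j = 0\<close>.\<close>

lemma dp_rows_0: "dp_rows n a m 0 s \<Longrightarrow> dp_rows n a (Suc m) n s"
  by (auto simp: dp_rows_def indep_prob_at_least_0 signed_choose_def split: if_splits)

lemma row_body_correct:
  assumes "frame n k a s" and "fst s ''i'' = Suc m" and "Suc m \<le> n"
    and "fst s ''j'' = Suc j" and "Suc j \<le> n" and "dp_rows n a m (Suc j) s"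
  defines "s' \<equiv> exec row_body s"
  shows "frame n k a s'" and "fst s' ''i'' = Suc m" and "fst s' ''j'' = j" and "dp_rows n a m j s'"
    and "snd s' ''E'' = snd s ''E''" and "snd s' ''O'' = snd s ''O''"
proof -
  show "frame n k a s'" "fst s' ''i'' = Suc m" "fst s' ''j'' = j"
    "snd s' ''E'' = snd s ''E''" "snd s' ''O'' = snd s ''O''"
    using assms(1-5) by (simp_all add: s'_def row_body_def frame_def)
  have a: "snd s ''a'' (Suc m) = a (Suc m)"
    using assms(1,3) by (simp add: frame_def)
  have old: "snd s ''T'' (Suc j) = indep_prob_at_least m (Suc j) a" "snd s ''T'' j = indep_prob_at_least m j a"
    "snd s ''D'' (Suc j) = signed_choose m (Suc j)" "snd s ''D'' j = signed_choose m j"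
    using assms(5,6) by (simp_all add: dp_rows_def)
  have T: "snd s' ''T'' = (snd s ''T'')(Suc j := indep_prob_at_least (Suc m) (Suc j) a)"
    using assms(2,4) by (simp add: s'_def row_body_def a old indep_prob_at_least_Suc)
  have D: "snd s' ''D'' = (snd s ''D'')(Suc j := signed_choose (Suc m) (Suc j))"
    using assms(2,4) by (simp add: s'_def row_body_def old signed_choose_Suc)
  show "dp_rows n a m j s'"
    using assms(6) unfolding dp_rows_def T D by (auto simp: less_Suc_eq_le le_Suc_eq)
qed

lemma row_loop_correct:
  assumes "frame n k a s" and "fst s ''i'' = Suc m" and "Suc m \<le> n" and "fst s ''j'' = n"
    and "dp_rows n a m n s"
  obtains s' where "runs_within row_loop s ((n + 1) * (4 + max_cost row_body)) s'"
    and "frame n k a s'" and "fst s' ''i'' = Suc m" and "dp_rows n a (Suc m) n s'"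
    and "snd s' ''E'' = snd s ''E''" and "snd s' ''O'' = snd s ''O''"
proof -
  define I where "I r \<longleftrightarrow> frame n k a r \<and> fst r ''i'' = Suc m \<and> fst r ''j'' \<le> n \<and>
    dp_rows n a m (fst r ''j'') r \<and> snd r ''E'' = snd s ''E'' \<and> snd r ''O'' = snd s ''O''" for r
  let ?b = "ILe (IConst 1) (IVar ''j'')"
  have straight_line: "straight_line row_body"
    by (simp add: row_body_def)
  \<comment> \<open>The measure is \<open>j\<close>, initially \<open>n\<close>; the 4 in the bound
    is the test of cost 3 plus the branch.\<close>
  have "\<exists>s'. runs_within row_loop s ((fst s ''j'' + 1) * (bcost ?b + 1 + max_cost row_body)) s'
      \<and> I s' \<and> \<not> bval ?b s'"
    unfolding row_loop_def
  proof (rule runs_within_While)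
    show "I s"
      using assms by (simp add: I_def)
    fix r assume r: "I r" "bval ?b r"
    then obtain j where j: "fst r ''j'' = Suc j"
      by (cases "fst r ''j''") auto
    note body = row_body_correct[of n k a r m j]
    have "I (exec row_body r)" "fst (exec row_body r) ''j'' < fst r ''j''"
      using body r j assms(3) by (simp_all add: I_def)
    then show "\<exists>s'. runs_within row_body r (max_cost row_body) s' \<and> I s' \<and> fst s' ''j'' < fst r ''j''"
      using runs_within_exec[of row_body r] straight_line by blast
  qed
  then obtain s' where s': "runs_within row_loop s ((n + 1) * (4 + max_cost row_body)) s'" "I s'"
    "fst s' ''j'' = 0"
    using assms(4) by (auto simp: numeral_eq_Suc)
  show ?thesis
    by (rule that[OF s'(1)]) (use s' dp_rows_0 in \<open>auto simp: I_def\<close>)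
qed

definition outer_inv :: "nat \<Rightarrow> nat \<Rightarrow> (nat \<Rightarrow> real) \<Rightarrow> state \<Rightarrow> bool" where
  "outer_inv n k a s \<longleftrightarrow> frame n k a s \<and> 1 \<le> fst s ''i'' \<and> fst s ''i'' \<le> n \<and>
     dp_rows n a (fst s ''i'' - 1) n s \<and>
     least_atom a {1..fst s ''i''} False (snd s ''E'' 0) \<and>
     least_atom a {1..fst s ''i''} True (snd s ''O'' 0)"

lemma step_minima_correct:
  assumes "frame n k a s" and i: "fst s ''i'' = Suc m" and m: "Suc m < n" and "dp_rows n a (Suc m) n s"
    and E: "least_atom a {1..Suc m} False (snd s ''E'' 0)"
    and O: "least_atom a {1..Suc m} True (snd s ''O'' 0)"
    and a: "\<forall>i\<in>{1..n}. 0 \<le> a i \<and> a i \<le> 1"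
  shows "outer_inv n k a (exec step_minima s)" and "fst (exec step_minima s) ''i'' = Suc (Suc m)"
proof -
  let ?s = "exec step_minima s"
  let ?x = "Suc (Suc m)"
  have ax: "snd s ''a'' ?x = a ?x"
    using assms(1) m by (simp add: frame_def)
  have E': "snd ?s ''E'' 0 = min (snd s ''E'' 0 * (1 - a ?x)) (snd s ''O'' 0 * a ?x)"
    using ax i by (simp add: step_minima_def min_def)
  have O': "snd ?s ''O'' 0 = min (snd s ''O'' 0 * (1 - a ?x)) (snd s ''E'' 0 * a ?x)"
    using ax i by (simp add: step_minima_def min_def)
  have x: "{1..?x} = insert ?x {1..Suc m}" "?x \<notin> {1..Suc m}" "?x \<in> {1..n}"
    using m by auto
  have "least_atom a {1..?x} False (snd ?s ''E'' 0)" "least_atom a {1..?x} True (snd ?s ''O'' 0)"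
    unfolding E' O' x(1) using x(2) a[rule_format, OF x(3)] E O by (auto intro!: least_atom_insert)
  moreover have "frame n k a ?s" "fst ?s ''i'' = ?x" "dp_rows n a (Suc m) n ?s"
    using assms(1,2,4) by (simp_all add: step_minima_def frame_def dp_rows_def)
  ultimately show "outer_inv n k a ?s" "fst ?s ''i'' = ?x"
    using m by (simp_all add: outer_inv_def)
qed

lemma outer_loop_correct:
  assumes "outer_inv n k a s" and a: "\<forall>i\<in>{1..n}. 0 \<le> a i \<and> a i \<le> 1"
  obtains s' where
    "runs_within outer_loop s ((n + 1) * (7 + (n + 1) * (4 + max_cost row_body) + max_cost step_minima)) s'"
    "outer_inv n k a s'" "fst s' ''i'' = n"
proof -
  let ?b = "BNot (ILe (IVar ''n'') (IVar ''i''))"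
  \<comment> \<open>The 2 is the cost of \<open>j := n\<close>. Test and branch add 5, giving the 7
    of the statement; the measure is \<open>n - i\<close>.\<close>
  let ?K = "2 + ((n + 1) * (4 + max_cost row_body) + max_cost step_minima)"
  have "\<exists>s'. runs_within outer_loop s ((n - fst s ''i'' + 1) * (bcost ?b + 1 + ?K)) s'
      \<and> outer_inv n k a s' \<and> \<not> bval ?b s'"
    unfolding outer_loop_def
  proof (rule runs_within_While)
    show "outer_inv n k a s" by fact
    fix r assume r: "outer_inv n k a r" "bval ?b r"
    then obtain m where m: "fst r ''i'' = Suc m" "Suc m < n"
      by (cases "fst r ''i''") (auto simp: outer_inv_def frame_def)
    define r1 where "r1 = exec (IAssign ''j'' (IVar ''n'')) r"
    have run1: "runs_within (IAssign ''j'' (IVar ''n'')) r 2 r1"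
      using runs_within_exec[of "IAssign ''j'' (IVar ''n'')" r] by (simp add: r1_def numeral_2_eq_2)
    have r1: "frame n k a r1" "fst r1 ''i'' = Suc m" "Suc m \<le> n" "fst r1 ''j'' = n" "dp_rows n a m n r1"
      "snd r1 = snd r"
      using r(1) m by (simp_all add: outer_inv_def r1_def frame_def dp_rows_def)
    obtain r2 where run2: "runs_within row_loop r1 ((n + 1) * (4 + max_cost row_body)) r2"
      and r2: "frame n k a r2" "fst r2 ''i'' = Suc m" "dp_rows n a (Suc m) n r2"
      "snd r2 ''E'' = snd r ''E''" "snd r2 ''O'' = snd r ''O''"
      using row_loop_correct[OF r1(1-5)] r1(6) by metis
    have run3: "runs_within step_minima r2 (max_cost step_minima) (exec step_minima r2)"
      by (rule runs_within_exec) (simp add: step_minima_def)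
    have "outer_inv n k a (exec step_minima r2)" "fst (exec step_minima r2) ''i'' = Suc (Suc m)"
      using step_minima_correct[OF r2(1,2) m(2) r2(3) _ _ a] r(1) m(1) r2(4,5)
      by (simp_all add: outer_inv_def)
    moreover from this have "n - fst (exec step_minima r2) ''i'' < n - fst r ''i''"
      using m by simp
    ultimately show "\<exists>s'. runs_within (Seq (IAssign ''j'' (IVar ''n'')) (Seq row_loop step_minima)) r ?K s'
        \<and> outer_inv n k a s' \<and> n - fst s' ''i'' < n - fst r ''i''"
      using runs_within_Seq[OF run1 runs_within_Seq[OF run2 run3]] by blast
  qed
  then obtain s' where s': "runs_within outer_loop s ((n - fst s ''i'' + 1) * (5 + ?K)) s'"
    "outer_inv n k a s'" "fst s' ''i'' = n"
    by (auto simp: outer_inv_def frame_def numeral_eq_Suc)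
  have "(n - fst s ''i'' + 1) * (5 + ?K) \<le> (n + 1) * (5 + ?K)"
    by (rule mult_right_mono) simp_all
  then have "runs_within outer_loop s ((n + 1) * (5 + ?K)) s'"
    using s'(1) unfolding runs_within_def by (meson order_trans)
  then show ?thesis
    using that[of s'] s'(2,3) by (simp add: add.assoc)
qed

lemma least_atom_singleton:
  "least_atom a {x} False (1 - a x)" "least_atom a {x} True (a x)"
proof -
  have sub: "S = {} \<or> S = {x}" if "S \<subseteq> {x}" for S
    using that by auto
  have empty: "atom_prob a {x} {} = 1 - a x" and full: "atom_prob a {x} {x} = a x"
    by (simp_all add: atom_prob_def)
  have "atom_prob a {x} S = 1 - a x" if "S \<subseteq> {x}" "odd (card S) = False" for S
    using sub[OF that(1)] that(2) empty by auto
  with empty show "least_atom a {x} False (1 - a x)"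
    unfolding least_atom_def by (intro conjI allI impI exI[of _ "{}"]) simp_all
  have "atom_prob a {x} S = a x" if "S \<subseteq> {x}" "odd (card S) = True" for S
    using sub[OF that(1)] that(2) full by auto
  with full show "least_atom a {x} True (a x)"
    unfolding least_atom_def by (intro conjI allI impI exI[of _ "{x}"]) simp_all
qed

lemma initialize_correct:
  assumes "1 \<le> n"
  shows "outer_inv n k a (exec initialize (input_state n k a))"
  using assms least_atom_singleton[of a "Suc 0"]
  by (simp add: outer_inv_def initialize_def input_state_def frame_def dp_rows_def
      indep_prob_at_least_no_events signed_choose_def)

lemma output_bounds_correct:
  assumes "outer_inv n k a s" and "fst s ''i'' = n" and "1 \<le> k" and "k \<le> n"
    and X: "X = indep_prob_at_least n k a - signed_choose (n - 1) (k - 1) * snd s ''O'' 0"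
    and Y: "Y = indep_prob_at_least n k a + signed_choose (n - 1) (k - 1) * snd s ''E'' 0"
  shows "snd (exec output_bounds s) ''L'' 0 = min X Y" and "snd (exec output_bounds s) ''U'' 0 = max X Y"
proof -
  have an: "snd s ''a'' n = a n" and k: "fst s ''k'' = k"
    using assms by (simp_all add: outer_inv_def frame_def)
  have T: "snd s ''T'' (k - 1) = indep_prob_at_least (n - 1) (k - 1) a"
    "snd s ''T'' k = indep_prob_at_least (n - 1) k a"
    and D: "snd s ''D'' (k - 1) = signed_choose (n - 1) (k - 1)"
    using assms by (simp_all add: outer_inv_def dp_rows_def)
  have P: "indep_prob_at_least n k a = a n * indep_prob_at_least (n - 1) (k - 1) a
      + (1 - a n) * indep_prob_at_least (n - 1) k a"
    using indep_prob_at_least_Suc[of "n - 1" "k - 1" a] assms(3,4) by simp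
  show "snd (exec output_bounds s) ''L'' 0 = min X Y" "snd (exec output_bounds s) ''U'' 0 = max X Y"
    using T D unfolding X Y P by (simp_all add: output_bounds_def assms(2) k an min_def max_def)
qed

text \<open>\<open>E\<close> and \<open>O\<close> end as least atoms, so uniqueness identifies them
  with any given \<alpha> and \<beta>. The program never determines the optimal segment
  length.\<close>

lemma bounds_program_correct:
  assumes "1 \<le> n" and "1 \<le> k" and "k \<le> n" and a: "\<forall>i\<in>{1..n}. 0 \<le> a i \<and> a i \<le> 1"
    and \<alpha>: "least_atom a {1..n} True \<alpha>" and \<beta>: "least_atom a {1..n} False \<beta>"
    and X: "X = indep_prob_at_least n k a - signed_choose (n - 1) (k - 1) * \<alpha>"
    and Y: "Y = indep_prob_at_least n k a + signed_choose (n - 1) (k - 1) * \<beta>"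
  obtains s where "runs_within bounds_program (input_state n k a) (poly [:500, 500, 500:] n) s"
    "snd s ''L'' 0 = min X Y" "snd s ''U'' 0 = max X Y"
proof -
  let ?s = "input_state n k a"
  have run1: "runs_within initialize ?s (max_cost initialize) (exec initialize ?s)"
    by (rule runs_within_exec) (simp add: initialize_def)
  obtain s where run2: "runs_within outer_loop (exec initialize ?s)
      ((n + 1) * (7 + (n + 1) * (4 + max_cost row_body) + max_cost step_minima)) s"
    and s: "outer_inv n k a s" "fst s ''i'' = n"
    using outer_loop_correct[OF initialize_correct[OF assms(1), of k a] a] by blast
  have run3: "runs_within output_bounds s (max_cost output_bounds) (exec output_bounds s)"
    by (rule runs_within_exec) (simp add: output_bounds_def)
  \<comment> \<open>The coefficients 500 are generous; simplification evaluates the fixed costs of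
    the loop-free pieces.\<close>
  have cost: "max_cost initialize + ((n + 1) * (7 + (n + 1) * (4 + max_cost row_body)
      + max_cost step_minima) + max_cost output_bounds) \<le> poly [:500, 500, 500:] n"
    by (simp add: initialize_def row_body_def step_minima_def output_bounds_def algebra_simps)
  have "runs_within bounds_program ?s (poly [:500, 500, 500:] n) (exec output_bounds s)"
    using runs_within_Seq[OF run1 runs_within_Seq[OF run2 run3]] order_trans[OF _ cost]
    unfolding runs_within_def bounds_program_def by blast
  moreover have "snd s ''O'' 0 = \<alpha>" "snd s ''E'' 0 = \<beta>"
    using s \<alpha> \<beta> by (auto simp: outer_inv_def intro: least_atom_unique)
  ultimately show ?thesis
    using output_bounds_correct[OF s assms(2,3)] X Y by (intro that) simp_all
qed

section \<open>Sharpness of the computed bounds\<close>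

lemma attainable_probs_between:
  assumes "2 \<le> n" and "1 \<le> k" and "x \<in> attainable_probs TYPE('w) n k a"
    and "least_atom a {1..n} True \<alpha>" and "least_atom a {1..n} False \<beta>"
    and X: "X = indep_prob_at_least n k a - signed_choose (n - 1) (k - 1) * \<alpha>"
    and Y: "Y = indep_prob_at_least n k a + signed_choose (n - 1) (k - 1) * \<beta>"
  shows "min X Y \<le> x \<and> x \<le> max X Y"
proof -
  obtain d where d: "- \<beta> \<le> d" "d \<le> \<alpha>"
    and x: "x = indep_prob_at_least n k a + (-1) ^ k * real ((n - 1) choose (k - 1)) * d"
    by (rule attainable_probsD[OF assms(1-5)])
  define c where "c = signed_choose (n - 1) (k - 1)"
  have x': "x = indep_prob_at_least n k a - c * d"
    unfolding x c_def signed_choose_def using \<open>1 \<le> k\<close> by (cases k) simp_all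
  show ?thesis
  \<comment> \<open>The value is affine in \<open>d\<close>, hence between its end point values; the
    sign of the slope decides which of \<open>X\<close> and \<open>Y\<close> is the larger.\<close>
  proof (cases "0 \<le> c")
    case True
    then have "c * (- \<beta>) \<le> c * d" "c * d \<le> c * \<alpha>"
      using d by (simp_all only: mult_left_mono)
    then show ?thesis
      unfolding X Y x' c_def[symmetric] by (simp add: min_le_iff_disj le_max_iff_disj)
  next
    case False
    then have "c * d \<le> c * (- \<beta>)" "c * \<alpha> \<le> c * d"
      using d by (simp_all only: mult_left_mono_neg not_le less_imp_le)
    then show ?thesis
      unfolding X Y x' c_def[symmetric] by (simp add: min_le_iff_disj le_max_iff_disj)
  qed
qed

text \<open>Attainment is shown on \<open>nat set\<close>, where the extremal measures are built;
  the bounds hold for every sample type \<open>'w\<close>.\<close>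

theorem theorem14:
  shows "\<exists>(prog :: com) (Q :: nat poly). \<forall>(n :: nat) (k :: nat) (a :: nat \<Rightarrow> real).
    2 \<le> n \<and> k \<in> {1..n} \<and> 0 \<le> a 1 \<and> mono_on {1..n} a \<and> a n \<le> 1 \<longrightarrow>
    (\<exists>t s L U.
       runs prog (input_state n k a) t s \<and> t \<le> poly Q n \<and>
       snd s ''L'' 0 = L \<and> snd s ''U'' 0 = U \<and>
       L \<in> attainable_probs TYPE(nat set) n k a \<and>
       U \<in> attainable_probs TYPE(nat set) n k a \<and>
       (\<forall>x \<in> attainable_probs TYPE(nat set) n k a. L \<le> x \<and> x \<le> U) \<and>
       (\<forall>x \<in> attainable_probs TYPE('w) n k a. L \<le> x \<and> x \<le> U) \<and>
       (odd k \<longrightarrow>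
          L = indep_prob_at_least n k a - real ((n - 1) choose (k - 1)) * alpha n a \<and>
          U = indep_prob_at_least n k a + real ((n - 1) choose (k - 1)) * beta n a) \<and>
       (even k \<longrightarrow>
          L = indep_prob_at_least n k a - real ((n - 1) choose (k - 1)) * beta n a \<and>
          U = indep_prob_at_least n k a + real ((n - 1) choose (k - 1)) * alpha n a))"
proof (intro exI[of _ bounds_program] exI[of _ "[:500, 500, 500:]"] allI impI)
  fix n k :: nat and a :: "nat \<Rightarrow> real"
  assume "2 \<le> n \<and> k \<in> {1..n} \<and> 0 \<le> a 1 \<and> mono_on {1..n} a \<and> a n \<le> 1"
  then have n: "2 \<le> n" "1 \<le> n" and k: "1 \<le> k" "k \<le> n"
    and ends: "0 \<le> a 1" "a n \<le> 1" and mono: "mono_on {1..n} a"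
    by auto
  have a: "0 \<le> a i \<and> a i \<le> 1" if "i \<in> {1..n}" for i
    using mono_onD[OF mono, of 1 i] mono_onD[OF mono, of i n] ends that n by auto
  have \<alpha>: "least_atom a {1..n} True (alpha n a)"
    by (rule least_atom_alpha[OF mono _ n(2)]) (rule a)
  have \<beta>: "least_atom a {1..n} False (beta n a)"
    by (rule least_atom_beta[OF mono]) (rule a)
  \<comment> \<open>Nonnegativity puts both end points into the admissible range of
    \<open>d\<close>, which needs minus \<beta> to be at most \<alpha>, and later orders
    \<open>X\<close> and \<open>Y\<close> for each parity of \<open>k\<close>.\<close>
  have nonneg: "0 \<le> alpha n a" "0 \<le> beta n a"
    using \<alpha> \<beta> atom_prob_nonneg[of "{1..n}" a] a unfolding least_atom_def by metis+
  define X where "X = indep_prob_at_least n k a - signed_choose (n - 1) (k - 1) * alpha n a"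
  define Y where "Y = indep_prob_at_least n k a + signed_choose (n - 1) (k - 1) * beta n a"
  define c where "c = real ((n - 1) choose (k - 1))"
  have "\<forall>i\<in>{1..n}. 0 \<le> a i \<and> a i \<le> 1"
    using a by blast
  then obtain s where s: "runs_within bounds_program (input_state n k a) (poly [:500, 500, 500:] n) s"
    "snd s ''L'' 0 = min X Y" "snd s ''U'' 0 = max X Y"
    by (rule bounds_program_correct[OF n(2) k _ \<alpha> \<beta> X_def Y_def])
  obtain t where t: "runs bounds_program (input_state n k a) t s" "t \<le> poly [:500, 500, 500:] n"
    using s(1) unfolding runs_within_def by blast
  have sign: "signed_choose (n - 1) (k - 1) = - ((-1) ^ k * c)"
    using k(1) unfolding signed_choose_def c_def by (cases k) simp_all
  \<comment> \<open>\<open>X\<close> is the value at \<open>d = alpha n a\<close>; likewise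
    \<open>Y\<close> below is the value at \<open>d = - beta n a\<close>.\<close>
  have "X = indep_prob_at_least n k a + (-1) ^ k * real ((n - 1) choose (k - 1)) * alpha n a"
    unfolding X_def sign c_def by simp
  then have X: "X \<in> attainable_probs TYPE(nat set) n k a"
    using attainable_probsI[OF n(1) k(1) \<alpha> \<beta>, of "alpha n a"] nonneg by simp
  have "Y = indep_prob_at_least n k a + (-1) ^ k * real ((n - 1) choose (k - 1)) * (- beta n a)"
    unfolding Y_def sign c_def by simp
  then have Y: "Y \<in> attainable_probs TYPE(nat set) n k a"
    using attainable_probsI[OF n(1) k(1) \<alpha> \<beta>, of "- beta n a"] nonneg by simp
  have "0 \<le> c * alpha n a" "0 \<le> c * beta n a"
    using nonneg by (simp_all add: c_def)
  then have odd: "min X Y = indep_prob_at_least n k a - c * alpha n a \<and>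
      max X Y = indep_prob_at_least n k a + c * beta n a" if "odd k"
    using that unfolding X_def Y_def sign by (auto simp: min_def max_def)
  have even: "min X Y = indep_prob_at_least n k a - c * beta n a \<and>
      max X Y = indep_prob_at_least n k a + c * alpha n a" if "even k"
    using that \<open>0 \<le> c * alpha n a\<close> \<open>0 \<le> c * beta n a\<close>
    unfolding X_def Y_def sign by (auto simp: min_def max_def)
  have attained: "min X Y \<in> attainable_probs TYPE(nat set) n k a" "max X Y \<in> attainable_probs TYPE(nat set) n k a"
    using X Y by (simp_all add: min_def max_def)
  have between_set: "\<forall>x\<in>attainable_probs TYPE(nat set) n k a. min X Y \<le> x \<and> x \<le> max X Y"
    and between: "\<forall>x\<in>attainable_probs TYPE('w) n k a. min X Y \<le> x \<and> x \<le> max X Y"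
    using attainable_probs_between[OF n(1) k(1) _ \<alpha> \<beta> X_def Y_def] by blast+
  show "\<exists>t s L U.
       runs bounds_program (input_state n k a) t s \<and> t \<le> poly [:500, 500, 500:] n \<and>
       snd s ''L'' 0 = L \<and> snd s ''U'' 0 = U \<and>
       L \<in> attainable_probs TYPE(nat set) n k a \<and>
       U \<in> attainable_probs TYPE(nat set) n k a \<and>
       (\<forall>x \<in> attainable_probs TYPE(nat set) n k a. L \<le> x \<and> x \<le> U) \<and>
       (\<forall>x \<in> attainable_probs TYPE('w) n k a. L \<le> x \<and> x \<le> U) \<and>
       (odd k \<longrightarrow>
          L = indep_prob_at_least n k a - real ((n - 1) choose (k - 1)) * alpha n a \<and>
          U = indep_prob_at_least n k a + real ((n - 1) choose (k - 1)) * beta n a) \<and>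
       (even k \<longrightarrow>
          L = indep_prob_at_least n k a - real ((n - 1) choose (k - 1)) * beta n a \<and>
          U = indep_prob_at_least n k a + real ((n - 1) choose (k - 1)) * alpha n a)"
    using t s(2,3) attained between_set between odd even unfolding c_def
    by (intro exI[of _ t] exI[of _ s] exI[of _ "min X Y"] exI[of _ "max X Y"] conjI impI) blast+
qed

end
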